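(* Let $d\in\mathbb{N}$, let $\mu$ be the standard $d$-dimensional Gaussian measure on $\mathbb{R}^d$, and let $\{X_n\}_{n\ge1}$ be a sequence of independent and identically distributed $d$-dimensional random vectors. Assume that the common law of the $X_n$'s is absolutely continuous with respect to $\mu$ with a density $g$ belonging to $\mathcal{L}^2(\mathbb{R}^d,\mu)$. Assume moreover that: (1) $g$ is of the form $$g(x)=\int_{\mathbb{R}^d}f(\sqrt\alpha\,x+\sqrt{1-\alpha}\,y)\,d\mu(y),\qquad x\in\mathbb{R}^d,$$ for some $\alpha\in\,]0,1[$ and some non-negative $f\in\mathcal{L}^2(\mathbb{R}^d,\mu)$; (2) $E[X_n]=0$ and the covariance matrix of the vector $X_n$ is the identity matrix. Then for every $n\ge\frac{\alpha}{1-\alpha}$ one has $$d_{TV}(\nu_{S_n},\mu)\le\frac12\,\frac1{\sqrt n}\Big(\frac{\alpha}{1-\alpha}\Big)^{\frac32}\big(\|f\|_2^2-1\big)^{\frac12},$$ where $\nu_{S_n}$ denotes the law of $S_n:=\frac{X_1+\cdots+X_n}{\sqrt n}$.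
   Context: $\mathcal{L}^2(\mathbb{R}^d,\mu)$ is the space of real-valued functions with $\|f\|_2=(\int_{\mathbb{R}^d}|f|^2d\mu)^{1/2}<\infty$. The total variation distance between probability measures $\nu_1,\nu_2$ on $\mathbb{R}^d$ is $d_{TV}(\nu_1,\nu_2):=\sup_{A\in\mathcal{B}(\mathbb{R}^d)}|\nu_1(A)-\nu_2(A)|$. *)

theory Defs
  imports "HOL-Probability.Probability"
begin

definition std_gaussian :: "(real ^ 'd) measure" where
  "std_gaussian =
     density lborel
       (\<lambda>x. ennreal ((2 * pi) powr (- real CARD('d) / 2) * exp (- (norm x)\<^sup>2 / 2)))"

(* Functions, not equivalence classes modulo null sets. *)
definition L2_space :: "'a measure \<Rightarrow> ('a \<Rightarrow> real) set" where
  "L2_space M = {f \<in> borel_measurable M. integrable M (\<lambda>x. \<bar>f x\<bar>\<^sup>2)}"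

definition L2_norm :: "'a measure \<Rightarrow> ('a \<Rightarrow> real) \<Rightarrow> real" where
  "L2_norm M f = sqrt (\<integral>x. \<bar>f x\<bar>\<^sup>2 \<partial>M)"

(* The supremum is the conditionally complete one on the reals, so this is meaningful
   for finite measures, where the differences are bounded. *)
definition tv_dist :: "('a::topological_space) measure \<Rightarrow> 'a measure \<Rightarrow> real" where
  "tv_dist \<nu>1 \<nu>2 = (SUP A\<in>sets borel. \<bar>measure \<nu>1 A - measure \<nu>2 A\<bar>)"

(* Intended for square-integrable Y: the Bochner integral of a non-integrable function is 0. *)
definition covariance_matrix :: "'a measure \<Rightarrow> ('a \<Rightarrow> real ^ 'd) \<Rightarrow> real ^ 'd ^ 'd" where
  "covariance_matrix M Y =
     (\<chi> i j. \<integral>\<omega>. (Y \<omega> $ i - (\<integral>\<omega>'. Y \<omega>' $ i \<partial>M)) *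
                  (Y \<omega> $ j - (\<integral>\<omega>'. Y \<omega>' $ j \<partial>M)) \<partial>M)"

definition normalized_sum :: "(nat \<Rightarrow> 'a \<Rightarrow> real ^ 'd) \<Rightarrow> nat \<Rightarrow> 'a \<Rightarrow> real ^ 'd" where
  "normalized_sum X n \<omega> = (1 / sqrt (real n)) *\<^sub>R (\<Sum>k=1..n. X k \<omega>)"

end

theory Submission
  imports Defs
begin

text \<open>
  Write \<open>\<gamma>\<close> for the standard Gaussian measure and \<open>ou c h x\<close> for the mean of
  \<open>h (c x + sqrt (1 - c\<^sup>2) N)\<close> with \<open>N\<close> of law \<open>\<gamma>\<close>; these are the Ornstein-Uhlenbeck operators, with
  time measured by \<open>c\<close>. They are symmetric on \<open>L\<^sup>2(\<gamma>)\<close> and satisfy \<open>ou a \<circ> ou b = ou (a * b)\<close>.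

  The hypothesis on the density is \<open>g = ou (sqrt \<alpha>) f\<close>. By symmetry of the operator this says that
  \<open>X\<close> has the law of \<open>sqrt \<alpha> Z + sqrt (1 - \<alpha>) N\<close>, where \<open>Z\<close> has density \<open>f\<close> and \<open>N\<close> is an independent
  Gaussian vector (\<open>density_ou\<close>). The normalized sum therefore has the law of
  \<open>sqrt (\<alpha> / n) (Z\<^sub>1 + \<dots> + Z\<^sub>n) + sqrt (1 - \<alpha>) N\<close>: a Gaussian component of variance \<open>1 - \<alpha>\<close> survives however
  large \<open>n\<close> is. The \<open>Z\<^sub>i\<close> are now exchanged for Gaussian vectors one at a time, as in Lindeberg's method.
  Convolution with a common summand does not increase total variation, so the exchange that follows
  \<open>j\<close> untouched summands costs at most the distance between the laws of
  \<open>sqrt (\<alpha> / n) Z + sqrt (1 - \<alpha> (j + 1) / n) N\<close> and \<open>sqrt (1 - \<alpha> j / n) N\<close>. After rescaling, the first law has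
  density \<open>ou c f\<close> with \<open>c\<^sup>2 = \<alpha> / (n - \<alpha> j)\<close> (\<open>lindeberg_step\<close>), and by the Cauchy-Schwarz inequality the
  distance is at most half the \<open>L\<^sup>2\<close> norm of \<open>ou c f - 1\<close>.

  The moment conditions on \<open>X\<close> make \<open>h = f - 1\<close> orthogonal to all polynomials of degree at most two, and
  on such functions \<open>ou c\<close> contracts the norm by \<open>c\<^sup>3\<close> (\<open>ou_third_order_contraction\<close>). In terms of Hermite
  expansions the reason is that \<open>ou c\<close> multiplies the chaos of order \<open>k\<close> by \<open>c\<^sup>k\<close>. The proof reads
  this off the kernel: a Taylor expansion of the Mehler kernel gives
  \<open>\<parallel>ou c h\<parallel> \<le> K c\<^sup>3\<close> for small \<open>c\<close> and some constant \<open>K\<close> that depends on \<open>h\<close>; and symmetry together with the semigroup law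
  gives \<open>\<parallel>ou c h\<parallel>\<^sup>2 \<le> \<parallel>h\<parallel> \<parallel>ou (c\<^sup>2) h\<parallel>\<close>. Iterating \<open>c \<mapsto> c\<^sup>2\<close> extracts roots of \<open>K\<close> of ever higher
  order, which replaces \<open>K\<close> by \<open>\<parallel>h\<parallel>\<close> and reaches every \<open>c < 1\<close>.

  Since \<open>n - \<alpha> j \<ge> n (1 - \<alpha>)\<close>, each of the \<open>n\<close> exchanges costs at most
  \<open>(\<alpha> / (n (1 - \<alpha>)))\<^bsup>3/2\<^esup> \<parallel>f - 1\<parallel> / 2\<close>, and \<open>\<parallel>f - 1\<parallel>\<^sup>2 = \<parallel>f\<parallel>\<^sup>2 - 1\<close>. This is the claimed bound.
\<close>

section \<open>The standard Gaussian measure\<close>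

definition gauss_density :: "real ^ 'd \<Rightarrow> real" where
  "gauss_density x = (2 * pi) powr (- real CARD('d) / 2) * exp (- (norm x)\<^sup>2 / 2)"

lemma std_gaussian_density: "std_gaussian = density lborel (\<lambda>x. ennreal (gauss_density x))"
  by (simp add: std_gaussian_def gauss_density_def)

lemma gauss_density_pos: "0 < gauss_density x"
  by (simp add: gauss_density_def)

lemma gauss_density_nonneg [simp]: "0 \<le> gauss_density x"
  using gauss_density_pos[of x] by simp

lemma borel_measurable_gauss_density [measurable]: "gauss_density \<in> borel_measurable borel"
  unfolding gauss_density_def [abs_def] by measurable

lemma sets_std_gaussian [simp, measurable_cong]: "sets std_gaussian = sets borel"
  by (simp add: std_gaussian_density)

lemma space_std_gaussian [simp]: "space std_gaussian = UNIV"
  by (simp add: std_gaussian_density)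

lemma norm_square_Basis: "(norm (x :: 'b::euclidean_space))\<^sup>2 = (\<Sum>b\<in>Basis. (x \<bullet> b)\<^sup>2)"
  unfolding power2_norm_eq_inner by (subst euclidean_inner) (simp add: power2_eq_square)

lemma gauss_density_prod:
  fixes x :: "real ^ 'd"
  shows "gauss_density x = (\<Prod>b\<in>Basis. std_normal_density (x \<bullet> b))"
proof -
  have "exp (- (norm x)\<^sup>2 / 2) = (\<Prod>b\<in>Basis. exp (- (x \<bullet> b)\<^sup>2 / 2))"
    by (simp add: norm_square_Basis exp_sum [symmetric] sum_negf sum_divide_distrib)
  moreover have "(2 * pi) powr (- real CARD('d) / 2) = (1 / sqrt (2 * pi)) ^ CARD('d)"
    by (simp add: powr_half_sqrt [symmetric] powr_powr powr_realpow [symmetric] powr_divide powr_minus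
          field_simps)
  ultimately show ?thesis
    by (simp add: gauss_density_def std_normal_density_def prod.distrib prod_constant prod_dividef power_divide)
qed

lemma lborel_prod:
  fixes f :: "'b::euclidean_space \<Rightarrow> real \<Rightarrow> real"
  assumes f: "\<And>b. b \<in> Basis \<Longrightarrow> integrable lborel (f b)"
  shows integrable_lborel_prod: "integrable (lborel :: 'b measure) (\<lambda>x. \<Prod>b\<in>Basis. f b (x \<bullet> b))"
    and integral_lborel_prod:
      "(\<integral>x. (\<Prod>b\<in>Basis. f b (x \<bullet> b)) \<partial>(lborel :: 'b measure)) = (\<Prod>b\<in>Basis. \<integral>t. f b t \<partial>lborel)"
proof -
  interpret P: product_sigma_finite "\<lambda>_::'b. lborel :: real measure" ..
  have [measurable]: "f b \<in> borel_measurable borel" if "b \<in> Basis" for b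
    using borel_measurable_integrable[OF f[OF that]] by simp
  have eq: "(\<Prod>b\<in>Basis. f b ((\<Sum>c\<in>Basis. w c *\<^sub>R c) \<bullet> b)) = (\<Prod>b\<in>Basis. f b (w b))" for w :: "'b \<Rightarrow> real"
    by (intro prod.cong) auto
  have i: "integrable (\<Pi>\<^sub>M b\<in>(Basis :: 'b set). (lborel :: real measure)) (\<lambda>w. \<Prod>b\<in>Basis. f b (w b))"
    by (intro P.product_integrable_prod f) auto
  show "integrable (lborel :: 'b measure) (\<lambda>x. \<Prod>b\<in>Basis. f b (x \<bullet> b))"
    using i unfolding lborel_eq [where 'a='b]
    by (subst integrable_distr_eq) (simp_all add: eq)
  show "(\<integral>x. (\<Prod>b\<in>Basis. f b (x \<bullet> b)) \<partial>(lborel :: 'b measure)) = (\<Prod>b\<in>Basis. \<integral>t. f b t \<partial>lborel)"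
    unfolding lborel_eq [where 'a='b]
    by (subst integral_distr) (simp_all add: eq P.product_integral_prod f)
qed

text \<open>
  The coordinates of a standard Gaussian vector are independent standard normal variables. This one
  formula yields total mass, second moments and exponential integrability below.
\<close>
lemma gaussian_prod:
  fixes f :: "real ^ 'd \<Rightarrow> real \<Rightarrow> real"
  assumes f: "\<And>b. b \<in> Basis \<Longrightarrow> integrable lborel (\<lambda>t. std_normal_density t * f b t)"
    and [measurable]: "\<And>b. b \<in> Basis \<Longrightarrow> f b \<in> borel_measurable borel"
  shows integrable_gaussian_prod: "integrable std_gaussian (\<lambda>x. \<Prod>b\<in>Basis. f b (x \<bullet> b))"
    and integral_gaussian_prod: "(\<integral>x. (\<Prod>b\<in>Basis. f b (x \<bullet> b)) \<partial>std_gaussian)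
      = (\<Prod>b\<in>Basis. \<integral>t. std_normal_density t * f b t \<partial>lborel)"
proof -
  show "integrable std_gaussian (\<lambda>x. \<Prod>b\<in>Basis. f b (x \<bullet> b))"
    using integrable_lborel_prod[of "\<lambda>b t. std_normal_density t * f b t", OF f] unfolding std_gaussian_density
    by (subst integrable_density) (simp_all add: gauss_density_prod prod.distrib prod_nonneg)
  show "(\<integral>x. (\<Prod>b\<in>Basis. f b (x \<bullet> b)) \<partial>std_gaussian)
      = (\<Prod>b\<in>Basis. \<integral>t. std_normal_density t * f b t \<partial>lborel)"
    using integral_lborel_prod[of "\<lambda>b t. std_normal_density t * f b t", OF f] unfolding std_gaussian_density
    by (subst integral_density) (simp_all add: gauss_density_prod prod.distrib prod_nonneg)
qed

lemma prob_space_std_gaussian: "prob_space (std_gaussian :: (real ^ 'd) measure)"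
proof
  have i: "integrable std_gaussian (\<lambda>x :: real ^ 'd. 1::real)"
    and e: "(\<integral>x. 1 \<partial>(std_gaussian :: (real ^ 'd) measure)) = (1::real)"
    using gaussian_prod[of "\<lambda>(_ :: real ^ 'd) _. 1 :: real"] by simp_all
  have "(\<integral>\<^sup>+x. 1 \<partial>(std_gaussian :: (real ^ 'd) measure)) = 1"
    using nn_integral_eq_integral[OF i] e by simp
  then show "emeasure (std_gaussian :: (real ^ 'd) measure) (space std_gaussian) = 1"
    by simp
qed

interpretation gauss: prob_space "std_gaussian :: (real ^ 'd) measure"
  by (rule prob_space_std_gaussian)

text \<open>
  The constant \<open>1/4\<close> is below the critical \<open>1/2\<close>; it allows a factor \<open>exp (\<bar>x\<bar>\<^sup>2 / 8)\<close> in
  estimates of functions in \<open>L\<^sup>2\<close>.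
\<close>
lemma integrable_exp_square_gaussian:
  "integrable std_gaussian (\<lambda>x :: real ^ 'd. exp ((norm x)\<^sup>2 / 4))"
proof -
  have eq: "exp ((norm x)\<^sup>2 / 4) = (\<Prod>b\<in>Basis. exp ((x \<bullet> b)\<^sup>2 / 4))" for x :: "real ^ 'd"
    by (simp add: norm_square_Basis exp_sum [symmetric] sum_divide_distrib)
  have "std_normal_density t * exp (t\<^sup>2 / 4) = sqrt 2 * normal_density 0 (sqrt 2) t" for t
    by (simp add: std_normal_density_def normal_density_def exp_add [symmetric] real_sqrt_mult field_simps)
  then have "integrable lborel (\<lambda>t. std_normal_density t * exp (t\<^sup>2 / 4))"
    by simp
  then show ?thesis
    unfolding eq by (intro integrable_gaussian_prod) auto
qed

lemma gaussian_second_moment: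
  fixes v :: "real ^ 'd"
  shows "(\<integral>x. (v \<bullet> x)\<^sup>2 \<partial>std_gaussian) = (norm v)\<^sup>2"
proof -
  have m: "integrable lborel (\<lambda>t. std_normal_density t * t ^ k)" for k
    by (rule integrable_std_normal_moment)
  \<comment> \<open>Exponents 1, 1 if \<open>b \<noteq> c\<close> and 2 if \<open>b = c\<close>, so that a mixed monomial is still a product over coordinates.\<close>
  have mon: "(x \<bullet> b) * (x \<bullet> c) = (\<Prod>e\<in>Basis. (x \<bullet> e) ^ (of_bool (e = b) + of_bool (e = c)))"
    if "b \<in> Basis" "c \<in> Basis" for b c x :: "real ^ 'd"
  proof -
    have "(\<Prod>e\<in>Basis. (x \<bullet> e) ^ of_bool (e = b')) = x \<bullet> b'" if "b' \<in> Basis" for b'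
      using that by (subst prod.remove[of _ b']) (auto intro!: prod.neutral)
    then show ?thesis using that by (simp add: power_add prod.distrib)
  qed
  have int: "integrable std_gaussian (\<lambda>x. (x \<bullet> b) * (x \<bullet> c))"
    if "b \<in> Basis" "c \<in> Basis" for b c :: "real ^ 'd"
    unfolding mon[OF that] by (intro integrable_gaussian_prod m) auto
  have val: "(\<integral>x. (x \<bullet> b) * (x \<bullet> c) \<partial>std_gaussian) = of_bool (b = c)"
    if bc: "b \<in> Basis" "c \<in> Basis" for b c :: "real ^ 'd"
  proof -
    have e: "(\<integral>x. (x \<bullet> b) * (x \<bullet> c) \<partial>std_gaussian) =
      (\<Prod>e\<in>Basis. \<integral>t. std_normal_density t * t ^ (of_bool (e = b) + of_bool (e = c)) \<partial>lborel)"
      unfolding mon[OF that] by (rule integral_gaussian_prod[OF m]) auto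
    have m1: "(\<integral>t. std_normal_density t * t \<partial>lborel) = 0"
      using integral_std_normal_moment_odd[of 0] by simp
    have m2: "(\<integral>t. std_normal_density t * (t * t) \<partial>lborel) = 1"
      using integral_std_normal_moment_even[of 1] by (simp add: power2_eq_square)
    show ?thesis
    proof (cases "b = c")
      case True
      then show ?thesis unfolding e
        by (auto intro!: prod.neutral simp: m2)
    next
      case False
      then show ?thesis unfolding e using bc
        by (auto intro!: prod_zero bexI[of _ b] simp: m1)
    qed
  qed
  have "(v \<bullet> x)\<^sup>2 = (\<Sum>b\<in>Basis. \<Sum>c\<in>Basis. (v \<bullet> b) * (v \<bullet> c) * ((x \<bullet> b) * (x \<bullet> c)))" for x
    by (subst euclidean_inner) (simp add: power2_eq_square sum_product ac_simps)
  then have "(\<integral>x. (v \<bullet> x)\<^sup>2 \<partial>std_gaussian) = (\<Sum>b\<in>Basis. \<Sum>c\<in>Basis. (v \<bullet> b) * (v \<bullet> c) * of_bool (b = c))"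
    using int val by (simp add: Bochner_Integration.integral_sum)
  also have "\<dots> = (\<Sum>b\<in>Basis. (v \<bullet> b) * (v \<bullet> b))"
    by (intro sum.cong refl) (simp add: of_bool_def if_distrib cong: if_cong)
  also have "\<dots> = (norm v)\<^sup>2"
    unfolding power2_norm_eq_inner by (subst (3) euclidean_inner) simp
  finally show ?thesis .
qed

section \<open>Rotation invariance and stability\<close>

lemma nn_integral_lborel_affine:
  fixes F :: "'b::euclidean_space \<Rightarrow> ennreal"
  assumes [measurable]: "F \<in> borel_measurable borel" and c: "c \<noteq> 0"
  shows "(\<integral>\<^sup>+x. F x \<partial>lborel) = ennreal (\<bar>c\<bar> ^ DIM('b)) * (\<integral>\<^sup>+x. F (t + c *\<^sub>R x) \<partial>lborel)"
  by (subst lborel_affine[OF c, of t])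
     (simp add: nn_integral_density nn_integral_distr nn_integral_cmult)

lemma nn_integral_std_gaussian:
  assumes [measurable]: "F \<in> borel_measurable borel"
  shows "(\<integral>\<^sup>+x. F x \<partial>std_gaussian) = (\<integral>\<^sup>+x. ennreal (gauss_density x) * F x \<partial>lborel)"
  unfolding std_gaussian_density by (subst nn_integral_density) auto

text \<open>
  A rotation of the product space factors into two maps, each of which changes only one of the two
  variables and is affine in it: with \<open>z\<close> held fixed replace \<open>y\<close> by \<open>u = s y + t z\<close>, and then with \<open>u\<close> held fixed replace
  \<open>z\<close> by \<open>v = (z - t u) / s\<close>. The Jacobians \<open>s\<close> and \<open>1 / s\<close> cancel.
\<close>
lemma nn_integral_rotation_lborel:
  fixes H :: "'b::euclidean_space \<times> 'b \<Rightarrow> ennreal"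
  assumes [measurable]: "H \<in> borel_measurable (borel \<Otimes>\<^sub>M borel)" and st: "s\<^sup>2 + t\<^sup>2 = 1" "s \<noteq> 0"
  shows "(\<integral>\<^sup>+y. \<integral>\<^sup>+z. H (s *\<^sub>R y + t *\<^sub>R z, s *\<^sub>R z - t *\<^sub>R y) \<partial>lborel \<partial>lborel) =
         (\<integral>\<^sup>+u. \<integral>\<^sup>+v. H (u, v) \<partial>lborel \<partial>lborel)"
proof -
  let ?k = "ennreal (\<bar>s\<bar> ^ DIM('b))"
  have "?k * (\<integral>\<^sup>+y. \<integral>\<^sup>+z. H (s *\<^sub>R y + t *\<^sub>R z, s *\<^sub>R z - t *\<^sub>R y) \<partial>lborel \<partial>lborel)
      = ?k * (\<integral>\<^sup>+z. \<integral>\<^sup>+y. H (s *\<^sub>R y + t *\<^sub>R z, s *\<^sub>R z - t *\<^sub>R y) \<partial>lborel \<partial>lborel)"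
    by (subst lborel_pair.Fubini') auto
  also have "\<dots> = (\<integral>\<^sup>+z. ?k * (\<integral>\<^sup>+y. H (s *\<^sub>R y + t *\<^sub>R z, s *\<^sub>R z - t *\<^sub>R y) \<partial>lborel) \<partial>lborel)"
    by (subst nn_integral_cmult) auto
  also have "\<dots> = (\<integral>\<^sup>+z. \<integral>\<^sup>+u. H (u, (1/s) *\<^sub>R z - (t/s) *\<^sub>R u) \<partial>lborel \<partial>lborel)"
  proof (intro nn_integral_cong)
    fix z :: 'b
    have r: "(t / s) * t + s = 1 / s"
      using st by (simp add: field_simps power2_eq_square)
    have "(1/s) *\<^sub>R z - (t/s) *\<^sub>R (t *\<^sub>R z + s *\<^sub>R y) = s *\<^sub>R z - t *\<^sub>R y" for y
      using st r[symmetric] by (simp add: algebra_simps)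
    then show "?k * (\<integral>\<^sup>+y. H (s *\<^sub>R y + t *\<^sub>R z, s *\<^sub>R z - t *\<^sub>R y) \<partial>lborel) =
        (\<integral>\<^sup>+u. H (u, (1/s) *\<^sub>R z - (t/s) *\<^sub>R u) \<partial>lborel)"
      by (subst nn_integral_lborel_affine[OF _ st(2), of _ "t *\<^sub>R z"]) (auto simp: add.commute)
  qed
  also have "\<dots> = (\<integral>\<^sup>+u. \<integral>\<^sup>+z. H (u, (1/s) *\<^sub>R z - (t/s) *\<^sub>R u) \<partial>lborel \<partial>lborel)"
    by (subst lborel_pair.Fubini') auto
  also have "\<dots> = (\<integral>\<^sup>+u. ?k * (\<integral>\<^sup>+v. H (u, v) \<partial>lborel) \<partial>lborel)"
  proof (intro nn_integral_cong)
    fix u :: 'b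
    have k: "?k * ennreal (\<bar>1/s\<bar> ^ DIM('b)) = 1"
      using st by (simp add: ennreal_mult'[symmetric] power_mult_distrib[symmetric] abs_mult[symmetric])
    have "(\<integral>\<^sup>+v. H (u, v) \<partial>lborel) = ennreal (\<bar>1/s\<bar> ^ DIM('b)) *
        (\<integral>\<^sup>+z. H (u, (1/s) *\<^sub>R z - (t/s) *\<^sub>R u) \<partial>lborel)"
      by (subst nn_integral_lborel_affine[of _ "1/s" "- (t/s) *\<^sub>R u"]) (use st in auto)
    then show "(\<integral>\<^sup>+z. H (u, (1/s) *\<^sub>R z - (t/s) *\<^sub>R u) \<partial>lborel) = ?k * (\<integral>\<^sup>+v. H (u, v) \<partial>lborel)"
      using k by (simp add: mult.assoc[symmetric])
  qed
  also have "\<dots> = ?k * (\<integral>\<^sup>+u. \<integral>\<^sup>+v. H (u, v) \<partial>lborel \<partial>lborel)"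
    by (subst nn_integral_cmult) auto
  finally show ?thesis
    using st by (simp add: ennreal_mult_cancel_left)
qed

lemma std_gaussian_pair_density:
  "(std_gaussian :: (real ^ 'd) measure) \<Otimes>\<^sub>M std_gaussian =
    density (lborel \<Otimes>\<^sub>M lborel) (\<lambda>(x, y). ennreal (gauss_density x) * ennreal (gauss_density y))"
  unfolding std_gaussian_density
  by (subst pair_measure_density)
     (auto intro!: gauss.sigma_finite_measure_axioms[unfolded std_gaussian_density] sigma_finite_lborel)

lemma gauss_density_rotation:
  assumes st: "s\<^sup>2 + t\<^sup>2 = 1"
  shows "gauss_density (s *\<^sub>R y + t *\<^sub>R z) * gauss_density (s *\<^sub>R z - t *\<^sub>R y) =
    gauss_density y * gauss_density z"
proof -
  have "(norm (s *\<^sub>R y + t *\<^sub>R z))\<^sup>2 + (norm (s *\<^sub>R z - t *\<^sub>R y))\<^sup>2 =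
      (s\<^sup>2 + t\<^sup>2) * (norm y)\<^sup>2 + (s\<^sup>2 + t\<^sup>2) * (norm z)\<^sup>2"
    unfolding power2_norm_eq_inner
    by (simp add: inner_simps inner_commute power2_eq_square algebra_simps)
  then have "- (norm (s *\<^sub>R y + t *\<^sub>R z))\<^sup>2 / 2 + - (norm (s *\<^sub>R z - t *\<^sub>R y))\<^sup>2 / 2 =
      - (norm y)\<^sup>2 / 2 + - (norm z)\<^sup>2 / 2"
    using st by simp
  then have "exp (- (norm (s *\<^sub>R y + t *\<^sub>R z))\<^sup>2 / 2) * exp (- (norm (s *\<^sub>R z - t *\<^sub>R y))\<^sup>2 / 2) =
      exp (- (norm y)\<^sup>2 / 2) * exp (- (norm z)\<^sup>2 / 2)"
    unfolding exp_add[symmetric] by simp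
  then show ?thesis
    by (simp add: gauss_density_def mult_ac)
qed

text \<open>The product density depends only on \<open>\<bar>y\<bar>\<^sup>2 + \<bar>z\<bar>\<^sup>2\<close>, which a rotation preserves.\<close>
lemma distr_gaussian_rotation:
  assumes st: "s\<^sup>2 + t\<^sup>2 = 1" "s \<noteq> 0"
  shows "distr (std_gaussian \<Otimes>\<^sub>M std_gaussian) (std_gaussian \<Otimes>\<^sub>M std_gaussian)
     (\<lambda>(y, z). (s *\<^sub>R y + t *\<^sub>R z, s *\<^sub>R z - t *\<^sub>R y)) =
     (std_gaussian :: (real ^ 'd) measure) \<Otimes>\<^sub>M std_gaussian" (is "distr ?P ?P ?R = ?P")
proof (rule measure_eqI)
  have [measurable_cong]: "sets ?P = sets (borel \<Otimes>\<^sub>M borel)"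
    by (intro sets_pair_measure_cong) auto
  have R[measurable]: "?R \<in> ?P \<rightarrow>\<^sub>M ?P" by measurable
  fix A assume "A \<in> sets (distr ?P ?P ?R)"
  then have A[measurable]: "A \<in> sets ?P" by simp
  define H where "H = (\<lambda>(x :: real ^ 'd, y :: real ^ 'd).
      ennreal (gauss_density x) * ennreal (gauss_density y) * indicator A (x, y))"
  have [measurable]: "H \<in> borel_measurable (borel \<Otimes>\<^sub>M borel)" unfolding H_def by measurable
  have HR: "ennreal (gauss_density y) * ennreal (gauss_density z) * indicator A (s *\<^sub>R y + t *\<^sub>R z, s *\<^sub>R z - t *\<^sub>R y) =
      H (s *\<^sub>R y + t *\<^sub>R z, s *\<^sub>R z - t *\<^sub>R y)" for y z
    using gauss_density_rotation[OF st(1), of y z] by (simp add: H_def ennreal_mult'[symmetric])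
  have "emeasure (distr ?P ?P ?R) A = (\<integral>\<^sup>+p. indicator A (?R p) \<partial>?P)"
    using nn_integral_distr[OF R, of "indicator A"] A by (simp add: sets_distr del: nn_integral_distr)
  also have "\<dots> = (\<integral>\<^sup>+p. H (?R p) \<partial>(lborel \<Otimes>\<^sub>M lborel))"
    unfolding std_gaussian_pair_density
    by (subst nn_integral_density) (auto intro!: nn_integral_cong simp: HR)
  also have "\<dots> = (\<integral>\<^sup>+y. \<integral>\<^sup>+z. H (s *\<^sub>R y + t *\<^sub>R z, s *\<^sub>R z - t *\<^sub>R y) \<partial>lborel \<partial>lborel)"
    by (subst lborel.nn_integral_fst[symmetric]) auto
  also have "\<dots> = (\<integral>\<^sup>+p. H p \<partial>(lborel \<Otimes>\<^sub>M lborel))"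
    by (subst nn_integral_rotation_lborel[OF _ st]) (auto simp: lborel.nn_integral_fst)
  also have "\<dots> = (\<integral>\<^sup>+p. indicator A p \<partial>?P)"
    unfolding std_gaussian_pair_density
    by (subst nn_integral_density) (auto intro!: nn_integral_cong simp: H_def)
  finally show "emeasure (distr ?P ?P ?R) A = emeasure ?P A"
    using nn_integral_indicator[OF A] by simp
qed simp

lemma distr_gaussian_uminus:
  "distr std_gaussian std_gaussian uminus = (std_gaussian :: (real ^ 'd) measure)"
proof (rule measure_eqI)
  fix A assume "A \<in> sets (distr std_gaussian std_gaussian (uminus :: real ^ 'd \<Rightarrow> _))"
  then have [measurable]: "A \<in> sets (borel :: (real ^ 'd) measure)" by simp
  have "emeasure (distr std_gaussian std_gaussian uminus) A
      = (\<integral>\<^sup>+x. indicator A (- x) \<partial>std_gaussian)"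
    using nn_integral_distr[of uminus std_gaussian std_gaussian "indicator A"] by simp
  also have "\<dots> = (\<integral>\<^sup>+x. ennreal (gauss_density x) * indicator A x \<partial>lborel)"
    by (subst nn_integral_std_gaussian)
       (auto simp: gauss_density_def nn_integral_lborel_affine[of "\<lambda>x. _ x * indicator A x" "-1" 0])
  also have "\<dots> = emeasure std_gaussian A"
    by (subst nn_integral_std_gaussian[symmetric]) auto
  finally show "emeasure (distr std_gaussian std_gaussian uminus) A = emeasure std_gaussian A" .
qed simp

definition gauss_law :: "real \<Rightarrow> (real ^ 'd) measure" where
  "gauss_law s = distr std_gaussian borel (\<lambda>x. s *\<^sub>R x)"

lemma sets_gauss_law [simp, measurable_cong]: "sets (gauss_law s) = sets borel"
  and space_gauss_law [simp]: "space (gauss_law s) = UNIV"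
  by (simp_all add: gauss_law_def)

lemma prob_space_gauss_law: "prob_space (gauss_law s)"
  unfolding gauss_law_def by (rule gauss.prob_space_distr) auto

lemma gauss_law_1: "gauss_law 1 = std_gaussian"
  unfolding gauss_law_def using distr_id2[of borel std_gaussian] by (simp add: scaleR_one[abs_def])

lemma gauss_law_0: "gauss_law 0 = return borel 0"
  unfolding gauss_law_def using gauss.distr_const[of 0 borel] by (simp add: scaleR_zero_left[abs_def])

lemma distr_fst_gaussian:
  "distr (std_gaussian \<Otimes>\<^sub>M std_gaussian) borel fst = (std_gaussian :: (real ^ 'd) measure)"
proof -
  have "distr (std_gaussian \<Otimes>\<^sub>M std_gaussian) std_gaussian fst = (std_gaussian :: (real ^ 'd) measure)"
    by (rule gauss.distr_pair_fst)
  then show ?thesis by (simp cong: distr_cong)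
qed

lemma convolution_scaled:
  fixes P Q :: "(real ^ 'd) measure"
  assumes "prob_space P" "prob_space Q" and [measurable_cong]: "sets P = sets borel" "sets Q = sets borel"
  shows "distr P borel (\<lambda>x. a *\<^sub>R x) \<star> distr Q borel (\<lambda>x. b *\<^sub>R x) =
    distr (P \<Otimes>\<^sub>M Q) borel (\<lambda>(x, y). a *\<^sub>R x + b *\<^sub>R y)"
proof -
  interpret P: prob_space P by fact
  interpret Q: prob_space Q by fact
  interpret Qb: prob_space "distr Q borel (\<lambda>x. b *\<^sub>R x)" by (rule Q.prob_space_distr) simp
  have "sigma_finite_measure (distr Q borel (\<lambda>x. b *\<^sub>R x))" ..
  then show ?thesis
    unfolding convolution_def
    by (subst pair_measure_distr) (auto simp: distr_distr intro!: distr_cong)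
qed

lemma convolution_return_0:
  fixes P :: "(real ^ 'd) measure"
  assumes "prob_space P" and [measurable_cong]: "sets P = sets borel"
  shows "return borel 0 \<star> P = P"
proof (rule measure_eqI)
  interpret P: prob_space P by fact
  interpret R: prob_space "return borel (0 :: real ^ 'd)" by (rule prob_space_return) simp
  fix A assume "A \<in> sets (return borel 0 \<star> P)"
  then have [measurable]: "A \<in> sets borel" by simp
  have "emeasure (return borel 0 \<star> P) A = (\<integral>\<^sup>+x. \<integral>\<^sup>+y. indicator A (x + y) \<partial>P \<partial>return borel 0)"
    using assms by (intro convolution_emeasure') (auto simp: P.finite_measure_axioms R.finite_measure_axioms)
  also have "\<dots> = (\<integral>\<^sup>+y. indicator A (0 + y) \<partial>P)"
    by (subst nn_integral_return) auto
  finally show "emeasure (return borel 0 \<star> P) A = emeasure P A" 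
    using assms by simp
qed (use assms in simp)

text \<open>Dividing by \<open>sqrt (a\<^sup>2 + b\<^sup>2)\<close> turns the sum into the first component of a rotated Gaussian pair.\<close>
lemma gauss_law_convolution:
  assumes "a \<ge> 0" "b \<ge> 0"
  shows "gauss_law a \<star> gauss_law b = (gauss_law (sqrt (a\<^sup>2 + b\<^sup>2)) :: (real ^ 'd) measure)"
proof (cases "a = 0")
  case True
  then show ?thesis using assms
    by (simp add: gauss_law_0 convolution_return_0[OF prob_space_gauss_law])
next
  case False
  define r where "r = sqrt (a\<^sup>2 + b\<^sup>2)"
  have r: "r > 0" "r\<^sup>2 = a\<^sup>2 + b\<^sup>2" using False by (auto simp: r_def sum_power2_gt_zero_iff)
  have st: "(a/r)\<^sup>2 + (b/r)\<^sup>2 = 1" "a/r \<noteq> 0"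
    using r False by (simp_all add: power_divide add_divide_distrib[symmetric])
  have "gauss_law a \<star> gauss_law b =
    distr (std_gaussian \<Otimes>\<^sub>M std_gaussian) borel (\<lambda>(x, y). a *\<^sub>R x + b *\<^sub>R (y :: real ^ 'd))"
    unfolding gauss_law_def by (intro convolution_scaled prob_space_std_gaussian) auto
  also have "\<dots> = distr (distr (distr (std_gaussian \<Otimes>\<^sub>M std_gaussian) (std_gaussian \<Otimes>\<^sub>M std_gaussian)
     (\<lambda>(y, z). ((a/r) *\<^sub>R y + (b/r) *\<^sub>R z, (a/r) *\<^sub>R z - (b/r) *\<^sub>R y))) borel fst) borel (\<lambda>x. r *\<^sub>R x)"
    using r by (auto simp: distr_distr algebra_simps intro!: distr_cong)
  also have "\<dots> = gauss_law r"
    by (simp add: distr_gaussian_rotation[OF st] distr_fst_gaussian gauss_law_def)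
  finally show ?thesis by (simp add: r_def)
qed

section \<open>Square-integrable functions\<close>

lemma L2_spaceI:
  "f \<in> borel_measurable M \<Longrightarrow> integrable M (\<lambda>x. (f x)\<^sup>2) \<Longrightarrow> f \<in> L2_space M"
  by (simp add: L2_space_def)

lemma L2_spaceD:
  assumes "f \<in> L2_space M"
  shows L2_measurable: "f \<in> borel_measurable M" and L2_integrable_square: "integrable M (\<lambda>x. (f x)\<^sup>2)"
  using assms by (simp_all add: L2_space_def)

lemma L2_integrable_mult:
  assumes "f \<in> L2_space M" "g \<in> L2_space M"
  shows "integrable M (\<lambda>x. f x * g x)"
proof (rule Bochner_Integration.integrable_bound)
  show "integrable M (\<lambda>x. (f x)\<^sup>2 + (g x)\<^sup>2)"
    by (intro Bochner_Integration.integrable_add L2_integrable_square assms)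
  show "(\<lambda>x. f x * g x) \<in> borel_measurable M"
    using assms[THEN L2_measurable] by measurable
  have "\<bar>a * b\<bar> \<le> \<bar>a\<^sup>2 + b\<^sup>2\<bar>" for a b :: real
    using sum_squares_bound[of "\<bar>a\<bar>" "\<bar>b\<bar>"] mult_nonneg_nonneg[OF abs_ge_zero abs_ge_zero, of a b]
    unfolding abs_mult power2_abs by (simp only: abs_of_nonneg)
  then show "AE x in M. norm (f x * g x) \<le> norm ((f x)\<^sup>2 + (g x)\<^sup>2)"
    by simp
qed

lemma L2_add:
  assumes "f \<in> L2_space M" "g \<in> L2_space M"
  shows "(\<lambda>x. f x + g x) \<in> L2_space M"
proof (rule L2_spaceI)
  show "(\<lambda>x. f x + g x) \<in> borel_measurable M"
    using assms[THEN L2_measurable] by measurable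
  have "integrable M (\<lambda>x. (f x)\<^sup>2 + 2 * (f x * g x) + (g x)\<^sup>2)"
    by (intro Bochner_Integration.integrable_add integrable_mult_right L2_integrable_square
        L2_integrable_mult assms)
  then show "integrable M (\<lambda>x. (f x + g x)\<^sup>2)"
    by (simp add: power2_sum algebra_simps)
qed

lemma L2_cmult: "f \<in> L2_space M \<Longrightarrow> (\<lambda>x. c * f x) \<in> L2_space M"
  by (auto intro!: L2_spaceI dest: L2_spaceD simp: power_mult_distrib)

lemma L2_diff:
  assumes "f \<in> L2_space M" "g \<in> L2_space M"
  shows "(\<lambda>x. f x - g x) \<in> L2_space M"
  using L2_add[OF assms(1) L2_cmult[OF assms(2), of "-1"]] by simp

lemma L2_bounded:
  fixes f :: "'a \<Rightarrow> real"
  assumes "finite_measure M" "f \<in> borel_measurable M" "\<And>x. \<bar>f x\<bar> \<le> B"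
  shows "f \<in> L2_space M"
proof (rule L2_spaceI)
  interpret finite_measure M by fact
  show "integrable M (\<lambda>x. (f x)\<^sup>2)"
  proof (rule integrable_const_bound)
    show "AE x in M. norm ((f x)\<^sup>2) \<le> B\<^sup>2"
      using power_mono[OF assms(3) abs_ge_zero, of _ 2] by simp
  qed (use assms(2) in measurable)
qed fact

lemma L2_integrable:
  assumes "finite_measure M" "f \<in> L2_space M"
  shows "integrable M f"
  using L2_integrable_mult[OF L2_bounded[OF assms(1), of "\<lambda>_. 1" 1] assms(2)] by simp

lemma L2_Cauchy_Schwarz:
  assumes f: "f \<in> L2_space M" and g: "g \<in> L2_space M"
  shows "(\<integral>x. f x * g x \<partial>M)\<^sup>2 \<le> (\<integral>x. (f x)\<^sup>2 \<partial>M) * (\<integral>x. (g x)\<^sup>2 \<partial>M)"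
proof -
  note fg = L2_integrable_mult[OF f g]
  have [measurable]: "f \<in> borel_measurable M" "g \<in> borel_measurable M"
    using f g by (auto dest: L2_measurable)
  have abs: "integrable M (\<lambda>x. \<bar>f x\<bar> * \<bar>g x\<bar>)"
    using integrable_abs[OF fg] by (simp add: abs_mult)
  have "ennreal ((\<integral>x. \<bar>f x\<bar> * \<bar>g x\<bar> \<partial>M)\<^sup>2) = (\<integral>\<^sup>+x. ennreal \<bar>f x\<bar> * ennreal \<bar>g x\<bar> \<partial>M)\<^sup>2"
    using nn_integral_eq_integral[OF abs] by (simp add: ennreal_mult'[symmetric] ennreal_power integral_nonneg_AE)
  also have "\<dots> \<le> (\<integral>\<^sup>+x. ennreal \<bar>f x\<bar> ^ 2 \<partial>M) * (\<integral>\<^sup>+x. ennreal \<bar>g x\<bar> ^ 2 \<partial>M)"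
    by (rule Cauchy_Schwarz_nn_integral) auto
  also have "\<dots> = ennreal ((\<integral>x. (f x)\<^sup>2 \<partial>M) * (\<integral>x. (g x)\<^sup>2 \<partial>M))"
    using nn_integral_eq_integral[OF L2_integrable_square[OF f]]
      nn_integral_eq_integral[OF L2_integrable_square[OF g]]
    by (simp add: ennreal_power ennreal_mult integral_nonneg_AE)
  finally have "(\<integral>x. \<bar>f x\<bar> * \<bar>g x\<bar> \<partial>M)\<^sup>2 \<le> (\<integral>x. (f x)\<^sup>2 \<partial>M) * (\<integral>x. (g x)\<^sup>2 \<partial>M)"
    by (simp add: ennreal_le_iff integral_nonneg_AE)
  moreover have "(\<integral>x. f x * g x \<partial>M)\<^sup>2 \<le> (\<integral>x. \<bar>f x\<bar> * \<bar>g x\<bar> \<partial>M)\<^sup>2"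
    using integral_abs_bound[of M "\<lambda>x. f x * g x"]
    by (intro power2_le_iff_abs_le[THEN iffD2]) (auto simp: abs_mult integral_nonneg_AE)
  ultimately show ?thesis by linarith
qed

section \<open>The Ornstein-Uhlenbeck operators\<close>

abbreviation gauss_pair :: "((real ^ 'd) \<times> (real ^ 'd)) measure" where
  "gauss_pair \<equiv> std_gaussian \<Otimes>\<^sub>M std_gaussian"

interpretation gauss2: pair_prob_space "std_gaussian :: (real ^ 'd) measure" "std_gaussian :: (real ^ 'd) measure" ..

lemma sets_gauss_pair [measurable_cong]:
  "sets (gauss_pair :: ((real ^ 'd) \<times> (real ^ 'd)) measure) = sets (borel \<Otimes>\<^sub>M borel)"
  by (intro sets_pair_measure_cong) auto

text \<open>
  The Ornstein-Uhlenbeck semigroup at time \<open>- ln c\<close>, given by Mehler's formula. Where \<open>h\<close> fails to be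
  integrable along the Gaussian average the value is 0; for integrable \<open>h\<close> this concerns a null set of \<open>x\<close> only
  (\<open>AE_integrable_ou\<close>).
\<close>
definition ou :: "real \<Rightarrow> (real ^ 'd \<Rightarrow> real) \<Rightarrow> real ^ 'd \<Rightarrow> real" where
  "ou c h x = (\<integral>y. h (c *\<^sub>R x + sqrt (1 - c\<^sup>2) *\<^sub>R y) \<partial>std_gaussian)"

lemma borel_measurable_ou [measurable]:
  assumes [measurable]: "h \<in> borel_measurable borel"
  shows "ou c h \<in> borel_measurable borel"
  unfolding ou_def by measurable

lemma L2_gaussian_measurable: "f \<in> L2_space std_gaussian \<Longrightarrow> f \<in> borel_measurable borel"
  using L2_measurable[of f std_gaussian] by (simp cong: measurable_cong_sets)

lemma ou_cos_sin: "0 < c \<Longrightarrow> c < 1 \<Longrightarrow> c\<^sup>2 + (sqrt (1 - c\<^sup>2))\<^sup>2 = (1::real)"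
  by (simp add: power_le_one)

text \<open>The Gaussian measure is stationary for the semigroup.\<close>
lemma distr_ou_marginal:
  assumes c: "0 < c" "c < 1"
  shows "distr gauss_pair borel (\<lambda>(x, y). c *\<^sub>R x + sqrt (1 - c\<^sup>2) *\<^sub>R y) = (std_gaussian :: (real ^ 'd) measure)"
proof -
  let ?s = "sqrt (1 - c\<^sup>2)"
  have "distr gauss_pair borel (\<lambda>(x, y). c *\<^sub>R x + ?s *\<^sub>R (y :: real ^ 'd)) = (gauss_law c \<star> gauss_law ?s)"
    unfolding gauss_law_def by (subst convolution_scaled) (auto intro!: prob_space_std_gaussian)
  also have "\<dots> = gauss_law 1"
    using c ou_cos_sin[OF c] by (subst gauss_law_convolution) (auto simp: power_le_one)
  finally show ?thesis by (simp add: gauss_law_1)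
qed

lemma ou_marginal:
  fixes h :: "real ^ 'd \<Rightarrow> real"
  assumes c: "0 < c" "c < 1" and h: "integrable std_gaussian h"
  shows integrable_ou_marginal: "integrable gauss_pair (\<lambda>(x, y). h (c *\<^sub>R x + sqrt (1 - c\<^sup>2) *\<^sub>R y))"
    and integral_ou_marginal:
      "(\<integral>(x, y). h (c *\<^sub>R x + sqrt (1 - c\<^sup>2) *\<^sub>R y) \<partial>gauss_pair) = (\<integral>x. h x \<partial>std_gaussian)"
proof -
  have [measurable]: "h \<in> borel_measurable borel"
    using borel_measurable_integrable[OF h] by simp
  note d = distr_ou_marginal[OF c, where 'd='d, unfolded case_prod_beta']
  show "integrable gauss_pair (\<lambda>(x, y). h (c *\<^sub>R x + sqrt (1 - c\<^sup>2) *\<^sub>R y))"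
    using integrable_distr_eq[of "\<lambda>(x, y). c *\<^sub>R x + sqrt (1 - c\<^sup>2) *\<^sub>R y" gauss_pair borel h] h
    by (simp add: d case_prod_beta')
  show "(\<integral>(x, y). h (c *\<^sub>R x + sqrt (1 - c\<^sup>2) *\<^sub>R y) \<partial>gauss_pair) = (\<integral>x. h x \<partial>std_gaussian)"
    using integral_distr[of "\<lambda>(x, y). c *\<^sub>R x + sqrt (1 - c\<^sup>2) *\<^sub>R y" gauss_pair borel h]
    by (simp add: d case_prod_beta')
qed

lemma AE_integrable_ou:
  fixes h :: "real ^ 'd \<Rightarrow> real"
  assumes c: "0 < c" "c < 1" and h: "integrable std_gaussian h"
  shows "AE x in std_gaussian. integrable std_gaussian (\<lambda>y. h (c *\<^sub>R x + sqrt (1 - c\<^sup>2) *\<^sub>R y))"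
  using gauss2.AE_integrable_fst'[OF integrable_ou_marginal[OF assms]] by simp

lemma integral_ou:
  fixes h :: "real ^ 'd \<Rightarrow> real"
  assumes c: "0 < c" "c < 1" and h: "integrable std_gaussian h"
  shows integrable_ou: "integrable std_gaussian (ou c h)"
    and "(\<integral>x. ou c h x \<partial>std_gaussian) = (\<integral>x. h x \<partial>std_gaussian)"
  using gauss2.integrable_fst'[OF integrable_ou_marginal[OF assms]]
    gauss2.integral_fst'[OF integrable_ou_marginal[OF assms]] integral_ou_marginal[OF assms]
  by (simp_all add: ou_def[abs_def])

text \<open>Pointwise \<open>(ou c h)\<^sup>2 \<le> ou c (h\<^sup>2)\<close> by Cauchy-Schwarz, and the right-hand side is integrable by stationarity.\<close>
lemma ou_L2:
  fixes h :: "real ^ 'd \<Rightarrow> real"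
  assumes c: "0 < c" "c < 1" and h: "h \<in> L2_space std_gaussian"
  shows "ou c h \<in> L2_space std_gaussian"
proof (rule L2_spaceI)
  have [measurable]: "h \<in> borel_measurable borel"
    using h by (rule L2_gaussian_measurable)
  show "ou c h \<in> borel_measurable std_gaussian" by measurable
  note h2 = L2_integrable_square[OF h]
  show "integrable std_gaussian (\<lambda>x. (ou c h x)\<^sup>2)"
  proof (rule Bochner_Integration.integrable_bound[OF integrable_ou[OF c h2]])
    show "AE x in std_gaussian. norm ((ou c h x)\<^sup>2) \<le> norm (ou c (\<lambda>x. (h x)\<^sup>2) x)"
      using AE_integrable_ou[OF c h2]
    proof eventually_elim
      case (elim x)
      let ?k = "\<lambda>y. h (c *\<^sub>R x + sqrt (1 - c\<^sup>2) *\<^sub>R y)"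
      have "?k \<in> L2_space std_gaussian"
        using elim by (intro L2_spaceI) auto
      from L2_Cauchy_Schwarz[OF this L2_bounded[of _ "\<lambda>_. 1" 1]]
      have "(\<integral>y. ?k y \<partial>std_gaussian)\<^sup>2 \<le> (\<integral>y. (?k y)\<^sup>2 \<partial>std_gaussian)"
        using gauss.finite_measure_axioms gauss.prob_space[where 'd='d] by simp
      then show ?case unfolding ou_def by simp
    qed
  qed measurable
qed

text \<open>
  Both sides are the mean of \<open>k(x) h(w)\<close> for a Gaussian pair with covariance \<open>c\<close>, a symmetric joint law.
  Concretely, rotate so that \<open>c x + s y\<close> becomes the first coordinate \<open>u\<close>; then \<open>x = c u - s v\<close>, and the
  sign of \<open>v\<close> is irrelevant.
\<close>
lemma ou_symmetric:
  fixes h k :: "real ^ 'd \<Rightarrow> real"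
  assumes c: "0 < c" "c < 1" and h: "h \<in> L2_space std_gaussian" and k: "k \<in> L2_space std_gaussian"
  shows "(\<integral>x. k x * ou c h x \<partial>std_gaussian) = (\<integral>x. h x * ou c k x \<partial>std_gaussian)"
proof -
  define s where "s = sqrt (1 - c\<^sup>2)"
  have cs: "c\<^sup>2 + (- s)\<^sup>2 = 1" using ou_cos_sin[OF c] by (simp add: s_def)
  have cs': "c * c + s * s = 1" using cs by (simp add: power2_eq_square)
  have [measurable]: "h \<in> borel_measurable borel" "k \<in> borel_measurable borel"
    using h k by (auto dest: L2_gaussian_measurable)
  define \<Phi> where "\<Phi> = (\<lambda>(x, y). k x * h (c *\<^sub>R x + s *\<^sub>R y))"
  have [measurable]: "\<Phi> \<in> borel_measurable (borel \<Otimes>\<^sub>M borel)" unfolding \<Phi>_def by measurable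
  have "integrable gauss_pair (\<lambda>p. (k (fst p))\<^sup>2)"
    using L2_integrable_square[OF k]
    by (subst (asm) distr_fst_gaussian[symmetric]) (simp add: integrable_distr_eq)
  then have "(\<lambda>p. k (fst p)) \<in> L2_space gauss_pair"
    by (intro L2_spaceI) auto
  moreover have "(\<lambda>(x, y). h (c *\<^sub>R x + s *\<^sub>R y)) \<in> L2_space gauss_pair"
    using integrable_ou_marginal[OF c L2_integrable_square[OF h]]
    by (intro L2_spaceI) (auto simp: s_def case_prod_beta')
  ultimately have i\<Phi>: "integrable gauss_pair \<Phi>"
    using L2_integrable_mult unfolding \<Phi>_def by (fastforce simp: case_prod_beta')
  \<comment> \<open>Rotation by the opposite angle, so that \<open>\<Phi> \<circ> ?R\<close> evaluates \<open>h\<close> at the first coordinate.\<close>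
  let ?R = "\<lambda>(y, z). (c *\<^sub>R y + (- s) *\<^sub>R z, c *\<^sub>R z - (- s) *\<^sub>R (y :: real ^ 'd))"
  have rot: "distr gauss_pair gauss_pair ?R = gauss_pair"
    using c by (intro distr_gaussian_rotation cs) simp
  have mR[measurable]: "?R \<in> gauss_pair \<rightarrow>\<^sub>M gauss_pair" by measurable
  have \<Phi>R: "\<Phi> (?R (u, v)) = h u * k (c *\<^sub>R u + s *\<^sub>R (- v))" for u v
  proof -
    have "c *\<^sub>R (c *\<^sub>R u + (- s) *\<^sub>R v) + s *\<^sub>R (c *\<^sub>R v - (- s) *\<^sub>R u) = (c * c + s * s) *\<^sub>R u"
      by (simp add: algebra_simps)
    then show ?thesis by (simp add: \<Phi>_def cs')
  qed
  have i\<Phi>R: "integrable gauss_pair (\<lambda>p. \<Phi> (?R p))"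
    using i\<Phi> by (subst (asm) rot[symmetric], subst (asm) integrable_distr_eq) auto
  have "(\<integral>x. k x * ou c h x \<partial>std_gaussian) = (\<integral>p. \<Phi> p \<partial>gauss_pair)"
    using gauss2.integral_fst'[OF i\<Phi>] by (simp add: \<Phi>_def ou_def s_def)
  also have "\<dots> = (\<integral>p. \<Phi> (?R p) \<partial>gauss_pair)"
    by (subst rot[symmetric], subst integral_distr) auto
  also have "\<dots> = (\<integral>u. \<integral>v. h u * k (c *\<^sub>R u + s *\<^sub>R (- v)) \<partial>std_gaussian \<partial>std_gaussian)"
    using gauss2.integral_fst'[OF i\<Phi>R] \<Phi>R by simp
  also have "\<dots> = (\<integral>u. h u * ou c k u \<partial>std_gaussian)"
  proof (intro Bochner_Integration.integral_cong refl)
    fix u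
    have "(\<integral>v. k (c *\<^sub>R u + s *\<^sub>R (- v)) \<partial>std_gaussian) = (\<integral>v. k (c *\<^sub>R u + s *\<^sub>R v) \<partial>std_gaussian)"
      using integral_distr[of uminus std_gaussian std_gaussian "\<lambda>v. k (c *\<^sub>R u + s *\<^sub>R v)"]
      by (simp add: distr_gaussian_uminus)
    then show "(\<integral>v. h u * k (c *\<^sub>R u + s *\<^sub>R (- v)) \<partial>std_gaussian) = h u * ou c k u"
      by (simp add: ou_def s_def)
  qed
  finally show ?thesis .
qed

text \<open>Two successive averages add independent Gaussian vectors, of total variance \<open>b\<^sup>2 (1 - a\<^sup>2) + (1 - b\<^sup>2) = 1 - (a b)\<^sup>2\<close>.\<close>
lemma ou_semigroup:
  fixes h :: "real ^ 'd \<Rightarrow> real"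
  assumes a: "0 < a" "a < 1" and b: "0 < b" "b < 1" and h: "integrable std_gaussian h"
  shows "AE x in std_gaussian. ou a (ou b h) x = ou (a * b) h x"
proof -
  have ab: "0 < a * b" "a * b < 1"
    using a b mult_strict_mono[of a 1 b 1] by auto
  have [measurable]: "h \<in> borel_measurable borel"
    using borel_measurable_integrable[OF h] by simp
  define s t r where "s = sqrt (1 - a\<^sup>2)" "t = sqrt (1 - b\<^sup>2)" "r = sqrt (1 - (a * b)\<^sup>2)"
  have le: "a\<^sup>2 \<le> 1" "b\<^sup>2 \<le> 1" using a b by (simp_all add: power_le_one)
  have r: "sqrt ((b * s)\<^sup>2 + t\<^sup>2) = r"
    using le by (simp add: s_t_r_def power_mult_distrib algebra_simps)
  have st0: "0 \<le> b * s" "0 \<le> t" using le b by (simp_all add: s_t_r_def)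
  have law: "distr gauss_pair borel (\<lambda>(y, z). (b * s) *\<^sub>R y + t *\<^sub>R z) = (gauss_law r :: (real ^ 'd) measure)"
    using gauss_law_convolution[OF st0, where 'd='d] unfolding r
    by (subst convolution_scaled[symmetric]) (auto simp: prob_space_std_gaussian gauss_law_def)
  show ?thesis
    using AE_integrable_ou[OF ab h]
  proof eventually_elim
    case (elim x)
    let ?k = "\<lambda>w. h ((a * b) *\<^sub>R x + w)"
    have "integrable (gauss_law r) ?k"
      using elim unfolding gauss_law_def by (subst integrable_distr_eq) (auto simp: s_t_r_def)
    then have i: "integrable gauss_pair (\<lambda>p. ?k ((b * s) *\<^sub>R fst p + t *\<^sub>R snd p))"
      unfolding law[symmetric] by (subst (asm) integrable_distr_eq) (auto simp: case_prod_beta')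
    have "ou a (ou b h) x = (\<integral>y. \<integral>z. ?k ((b * s) *\<^sub>R y + t *\<^sub>R z) \<partial>std_gaussian \<partial>std_gaussian)"
      by (simp add: ou_def s_t_r_def algebra_simps)
    also have "\<dots> = (\<integral>p. ?k ((b * s) *\<^sub>R fst p + t *\<^sub>R snd p) \<partial>gauss_pair)"
      using gauss2.integral_fst'[OF i] by simp
    also have "\<dots> = (\<integral>w. ?k w \<partial>gauss_law r)"
      unfolding law[symmetric] by (subst integral_distr) (auto simp: case_prod_beta')
    also have "\<dots> = ou (a * b) h x"
      unfolding gauss_law_def ou_def by (subst integral_distr) (auto simp: s_t_r_def)
    finally show ?case .
  qed
qed

text \<open>By symmetry and the semigroup law \<open>\<parallel>ou c h\<parallel>\<^sup>2 = \<langle>h, ou (c\<^sup>2) h\<rangle>\<close>; then the Cauchy-Schwarz inequality applies.\<close>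
lemma ou_doubling:
  fixes h :: "real ^ 'd \<Rightarrow> real"
  assumes c: "0 < c" "c < 1" and h: "h \<in> L2_space std_gaussian"
  shows "(\<integral>x. (ou c h x)\<^sup>2 \<partial>std_gaussian)\<^sup>2 \<le>
    (\<integral>x. (h x)\<^sup>2 \<partial>std_gaussian) * (\<integral>x. (ou (c\<^sup>2) h x)\<^sup>2 \<partial>std_gaussian)"
proof -
  have c2: "0 < c\<^sup>2" "c\<^sup>2 < 1" using c by (simp_all add: power_less_one_iff)
  have [measurable]: "h \<in> borel_measurable borel"
    using h by (rule L2_gaussian_measurable)
  have ih: "integrable std_gaussian h"
    using h by (rule L2_integrable[OF gauss.finite_measure_axioms])
  have "(\<integral>x. (ou c h x)\<^sup>2 \<partial>std_gaussian) = (\<integral>x. h x * ou c (ou c h) x \<partial>std_gaussian)"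
    using ou_symmetric[OF c h ou_L2[OF c h]] by (simp add: power2_eq_square)
  also have "\<dots> = (\<integral>x. h x * ou (c\<^sup>2) h x \<partial>std_gaussian)"
    by (intro integral_cong_AE) (use ou_semigroup[OF c c ih] in \<open>auto simp: power2_eq_square\<close>)
  finally show ?thesis
    using L2_Cauchy_Schwarz[OF h ou_L2[OF c2 h]] by simp
qed

text \<open>
  The probabilistic meaning of the operator: if \<open>Z\<close> has density \<open>f\<close> and \<open>N\<close> is an independent Gaussian vector, then
  \<open>ou c f\<close> is the density of \<open>c Z + sqrt (1 - c\<^sup>2) N\<close>. It is symmetry tested on indicator functions.
\<close>
lemma density_ou:
  fixes f :: "real ^ 'd \<Rightarrow> real"
  assumes c: "0 < c" "c < 1" and f: "f \<in> L2_space std_gaussian" and f0: "\<And>x. 0 \<le> f x"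
  shows "density std_gaussian (\<lambda>x. ennreal (ou c f x)) =
    (distr (density std_gaussian (\<lambda>x. ennreal (f x))) borel (\<lambda>x. c *\<^sub>R x) \<star> gauss_law (sqrt (1 - c\<^sup>2)))"
    (is "?L = (?D \<star> ?G)")
proof (rule measure_eqI)
  have [measurable]: "f \<in> borel_measurable borel"
    using f by (rule L2_gaussian_measurable)
  have "integrable std_gaussian f"
    using f by (rule L2_integrable[OF gauss.finite_measure_axioms])
  then have "(\<integral>\<^sup>+x. ennreal (f x) \<partial>std_gaussian) < \<infinity>"
    using nn_integral_eq_integral[of std_gaussian f] f0 by simp
  then have "finite_measure (density std_gaussian (\<lambda>x. ennreal (f x)))"
    by (intro finite_measureI) (simp add: emeasure_density less_top)
  then have D: "finite_measure ?D"
    by (intro finite_measure.finite_measure_distr) auto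
  have G: "finite_measure ?G"
    using prob_space_gauss_law by (rule prob_space.finite_measure)
  fix A assume "A \<in> sets ?L"
  then have [measurable]: "A \<in> sets borel" by simp
  have A2: "indicat_real A \<in> L2_space std_gaussian"
    by (intro L2_bounded[of _ _ 1] gauss.finite_measure_axioms) (auto simp: indicator_def)
  have f_ou: "0 \<le> ou c f x" for x
    unfolding ou_def using f0 by simp
  have ouA: "ennreal (ou c (indicat_real A) x) =
      (\<integral>\<^sup>+y. indicator A (c *\<^sub>R x + y) \<partial>?G)" for x
  proof -
    have "integrable std_gaussian (\<lambda>y. indicat_real A (c *\<^sub>R x + sqrt (1 - c\<^sup>2) *\<^sub>R y))"
      by (rule gauss.integrable_const_bound[where B=1]) (auto simp: indicator_def)
    from nn_integral_eq_integral[OF this] show ?thesis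
      unfolding gauss_law_def ou_def by (subst nn_integral_distr) (auto simp: ennreal_indicator)
  qed
  have "emeasure ?L A = (\<integral>\<^sup>+x. ennreal (indicat_real A x * ou c f x) \<partial>std_gaussian)"
    by (subst emeasure_density) (auto simp: ennreal_mult' f_ou ennreal_indicator mult.commute)
  also have "\<dots> = ennreal (\<integral>x. indicat_real A x * ou c f x \<partial>std_gaussian)"
    by (intro nn_integral_eq_integral L2_integrable_mult A2 ou_L2 c f) (simp add: f_ou)
  also have "\<dots> = ennreal (\<integral>x. f x * ou c (indicat_real A) x \<partial>std_gaussian)"
    by (simp add: ou_symmetric[OF c f A2])
  also have "\<dots> = (\<integral>\<^sup>+x. ennreal (f x * ou c (indicat_real A) x) \<partial>std_gaussian)"
    by (intro nn_integral_eq_integral[symmetric] L2_integrable_mult f ou_L2 c A2)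
       (simp add: f0 ou_def)
  also have "\<dots> = (\<integral>\<^sup>+x. ennreal (f x) * (\<integral>\<^sup>+y. indicator A (c *\<^sub>R x + y) \<partial>?G) \<partial>std_gaussian)"
    by (simp add: ennreal_mult' f0 ouA)
  also have "\<dots> = (\<integral>\<^sup>+x. \<integral>\<^sup>+y. indicator A (x + y) \<partial>?G \<partial>?D)"
  proof -
    interpret G: finite_measure "?G :: (real ^ 'd) measure" by (rule G)
    show ?thesis
      by (subst nn_integral_distr, measurable, subst nn_integral_density) auto
  qed
  also have "\<dots> = emeasure (?D \<star> ?G) A"
    using D G by (intro convolution_emeasure'[symmetric]) auto
  finally show "emeasure ?L A = emeasure (?D \<star> ?G) A" .
qed simp

section \<open>Third-order contraction\<close>

text \<open>
  Up to the normalization \<open>(1 - c\<^sup>2)\<^bsup>-d/2\<^esup>\<close> its exponential is the Mehler kernel, the density of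
  \<open>c x + sqrt (1 - c\<^sup>2) N\<close> with respect to the Gaussian measure.
\<close>
definition mehler_exponent :: "real \<Rightarrow> real ^ 'd \<Rightarrow> real ^ 'd \<Rightarrow> real" where
  "mehler_exponent c x y =
     (2 * c * (x \<bullet> y) - c\<^sup>2 * ((norm x)\<^sup>2 + (norm y)\<^sup>2)) / (2 * (1 - c\<^sup>2))"

lemma integral_lborel_affine:
  fixes F :: "'b::euclidean_space \<Rightarrow> real"
  assumes [measurable]: "F \<in> borel_measurable borel" and c: "c \<noteq> 0"
  shows "(\<integral>x. F x \<partial>lborel) = \<bar>c\<bar> ^ DIM('b) * (\<integral>x. F (t + c *\<^sub>R x) \<partial>lborel)"
  by (subst lborel_affine[OF c, of t])
     (simp add: integral_density integral_distr)

lemma ou_kernel: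
  fixes h :: "real ^ 'd \<Rightarrow> real"
  assumes c: "0 < c" "c < 1" and [measurable]: "h \<in> borel_measurable borel"
  shows "ou c h x = (1 / sqrt (1 - c\<^sup>2)) ^ CARD('d) * (\<integral>y. h y * exp (mehler_exponent c x y) \<partial>std_gaussian)"
proof -
  define s where "s = sqrt (1 - c\<^sup>2)"
  have c2: "c\<^sup>2 < 1" using c by (simp add: power_less_one_iff)
  have s: "s > 0" "s\<^sup>2 = 1 - c\<^sup>2" using c2 by (auto simp: s_def)
  have kernel: "gauss_density ((1/s) *\<^sub>R (y - c *\<^sub>R x)) = gauss_density y * exp (mehler_exponent c x y)" for y
  proof -
    have "- (norm ((1/s) *\<^sub>R (y - c *\<^sub>R x)))\<^sup>2 / 2 = - (norm y)\<^sup>2 / 2 + mehler_exponent c x y"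
    proof -
      have "(norm ((1/s) *\<^sub>R (y - c *\<^sub>R x)))\<^sup>2 = (norm (y - c *\<^sub>R x))\<^sup>2 / s\<^sup>2"
        using s by (simp add: power_mult_distrib power_divide)
      also have "\<dots> = ((norm y)\<^sup>2 - 2 * c * (x \<bullet> y) + c\<^sup>2 * (norm x)\<^sup>2) / (1 - c\<^sup>2)"
        unfolding s power2_norm_eq_inner
        by (simp add: inner_simps inner_commute power2_eq_square algebra_simps)
      finally show ?thesis
        using c2 by (simp add: mehler_exponent_def field_simps)
    qed
    then have "exp (- (norm ((1/s) *\<^sub>R (y - c *\<^sub>R x)))\<^sup>2 / 2) =
        exp (- (norm y)\<^sup>2 / 2) * exp (mehler_exponent c x y)"
      by (simp only: exp_add)
    then show ?thesis by (simp add: gauss_density_def)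
  qed
  have [measurable]: "mehler_exponent c x \<in> borel_measurable borel"
    unfolding mehler_exponent_def[abs_def] by measurable
  have "ou c h x = (\<integral>y. gauss_density y * h (c *\<^sub>R x + s *\<^sub>R y) \<partial>lborel)"
    unfolding ou_def std_gaussian_density s_def[symmetric]
    by (subst integral_density) auto
  also have "\<dots> = \<bar>1/s\<bar> ^ DIM(real ^ 'd) * (\<integral>y. gauss_density (- (c/s) *\<^sub>R x + (1/s) *\<^sub>R y) *
      h (c *\<^sub>R x + s *\<^sub>R (- (c/s) *\<^sub>R x + (1/s) *\<^sub>R y)) \<partial>lborel)"
    using s by (intro integral_lborel_affine) auto
  also have "\<dots> = (1/s) ^ CARD('d) * (\<integral>y. gauss_density y * (h y * exp (mehler_exponent c x y)) \<partial>lborel)"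
  proof -
    have "c *\<^sub>R x + s *\<^sub>R (- (c/s) *\<^sub>R x + (1/s) *\<^sub>R y) = y" for y
      using s by (simp add: algebra_simps)
    moreover have "- (c/s) *\<^sub>R x + (1/s) *\<^sub>R y = (1/s) *\<^sub>R (y - c *\<^sub>R x)" for y
      by (simp add: algebra_simps)
    ultimately show ?thesis
      using s by (simp only: kernel) (simp add: mult_ac)
  qed
  also have "(\<integral>y. gauss_density y * (h y * exp (mehler_exponent c x y)) \<partial>lborel) =
      (\<integral>y. h y * exp (mehler_exponent c x y) \<partial>std_gaussian)"
    unfolding std_gaussian_density by (subst integral_density) auto
  finally show ?thesis by (simp add: s_def)
qed

lemma abs_exp_taylor2_le: "\<bar>exp t - 1 - t - t\<^sup>2 / 2\<bar> \<le> \<bar>t\<bar> ^ 3 * exp \<bar>t :: real\<bar>"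
proof -
  obtain r where r: "\<bar>r\<bar> \<le> \<bar>t\<bar>" "exp t = (\<Sum>m<3. t ^ m / fact m) + exp r / fact 3 * t ^ 3"
    using Maclaurin_exp_le[of t 3] by blast
  have "exp t - 1 - t - t\<^sup>2 / 2 = exp r / 6 * t ^ 3"
    unfolding r(2) by (simp add: numeral_3_eq_3 fact_numeral power2_eq_square)
  then have "\<bar>exp t - 1 - t - t\<^sup>2 / 2\<bar> = \<bar>t\<bar> ^ 3 * (exp r / 6)"
    by (simp only: abs_mult power_abs abs_divide abs_exp_cancel abs_numeral mult.commute)
  also have "\<dots> \<le> \<bar>t\<bar> ^ 3 * exp \<bar>t\<bar>"
  proof (rule mult_left_mono)
    have "exp r \<le> exp \<bar>t\<bar>" using r(1) by simp
    then show "exp r / 6 \<le> exp \<bar>t\<bar>" using exp_gt_zero[of "\<bar>t\<bar>"] by linarith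
  qed simp
  finally show ?thesis .
qed

text \<open>
  The subtracted terms form a polynomial in \<open>y\<close> of degree two. They differ from the second-order Taylor
  polynomial of the exponential in the exponent \<open>\<theta>\<close> in that \<open>\<theta>\<^sup>2 / 2\<close>, which has degree four in \<open>y\<close>, is cut down to its leading
  part in \<open>c\<close>; what is dropped is of order \<open>c\<^sup>3\<close>, like the Taylor remainder. Polynomial growth is absorbed in the exponential
  factor, and \<open>1/8\<close> is small enough for that factor to be in \<open>L\<^sup>2\<close> of the Gaussian measure.
\<close>
lemma mehler_remainder:
  fixes x y :: "real ^ 'd"
  defines "Q \<equiv> (norm x)\<^sup>2 + (norm y)\<^sup>2"
  assumes c: "0 < c" "c \<le> 1 / 16"
  shows "\<bar>exp (mehler_exponent c x y) -
      (1 + mehler_exponent c x y + (c * (x \<bullet> y) / (1 - c\<^sup>2))\<^sup>2 / 2)\<bar> \<le> 120000 * c ^ 3 * exp (Q / 8)"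
proof -
  define \<theta> where "\<theta> = mehler_exponent c x y"
  define p where "p = x \<bullet> y"
  define w where "w = 1 / (1 - c\<^sup>2)"
  have Q0: "Q \<ge> 0" by (simp add: Q_def)
  have p: "\<bar>p\<bar> \<le> Q / 2"
  proof -
    have "\<bar>p\<bar> \<le> norm x * norm y" unfolding p_def by (rule Cauchy_Schwarz_ineq2)
    also have "\<dots> \<le> Q / 2" using sum_squares_bound[of "norm x" "norm y"] by (simp add: Q_def)
    finally show ?thesis .
  qed
  have c2: "c\<^sup>2 \<le> 1/16 * c" using c by (simp add: power2_eq_square)
  have "c\<^sup>2 \<le> 1/256" using c2 c by simp
  then have w: "1 \<le> w" "w \<le> 256/255" by (simp_all add: w_def field_simps)
  have \<theta>: "\<theta> = w * (c * p - c\<^sup>2 * Q / 2)"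
    using \<open>c\<^sup>2 \<le> 1/256\<close> by (simp add: \<theta>_def mehler_exponent_def w_def p_def Q_def field_simps)
  have \<theta>_le: "\<bar>\<theta>\<bar> \<le> c * Q"
  proof -
    have "\<bar>c * p\<bar> \<le> c * (Q / 2)" using c p by (simp add: abs_mult)
    moreover have "\<bar>c\<^sup>2 * Q / 2\<bar> \<le> c * Q / 32"
      using mult_right_mono[OF c2 Q0] Q0 by (simp add: mult_ac)
    ultimately have "\<bar>c * p - c\<^sup>2 * Q / 2\<bar> \<le> 17/32 * (c * Q)"
      by linarith
    then have "\<bar>\<theta>\<bar> \<le> 256/255 * (17/32 * (c * Q))"
      unfolding \<theta> abs_mult using w by (intro mult_mono) auto
    also have "\<dots> \<le> c * Q" using c Q0 by simp
    finally show ?thesis .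
  qed
  have cQ: "c * Q \<le> Q / 16" using mult_right_mono[OF c(2) Q0] by simp
  \<comment> \<open>Powers of \<open>Q\<close> against exponentials: \<open>48 = 3 \<cdot> 16\<close> and \<open>32 = 2 \<cdot> 16\<close>, so both bounds come out with \<open>exp (Q / 16)\<close>.\<close>
  have e1: "Q ^ 3 \<le> 110592 * exp (Q / 16)"
  proof -
    have "Q / 48 \<le> exp (Q / 48)" using exp_ge_add_one_self[of "Q/48"] by linarith
    then have "(Q / 48) ^ 3 \<le> exp (Q / 48) ^ 3" using Q0 by (intro power_mono) auto
    then show ?thesis by (simp add: exp_of_nat_mult[symmetric] power_divide field_simps)
  qed
  have e2: "Q\<^sup>2 \<le> 1024 * exp (Q / 16)"
  proof -
    have "Q / 32 \<le> exp (Q / 32)" using exp_ge_add_one_self[of "Q/32"] by linarith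
    then have "(Q / 32)\<^sup>2 \<le> exp (Q / 32) ^ 2" using Q0 by (intro power_mono) auto
    then show ?thesis by (simp add: exp_of_nat_mult[symmetric] power_divide field_simps)
  qed
  have "\<bar>exp \<theta> - 1 - \<theta> - \<theta>\<^sup>2 / 2\<bar> \<le> \<bar>\<theta>\<bar> ^ 3 * exp \<bar>\<theta>\<bar>" by (rule abs_exp_taylor2_le)
  also have "\<dots> \<le> (c * Q) ^ 3 * exp (Q / 16)"
    using \<theta>_le cQ c Q0 by (intro mult_mono power_mono) auto
  also have "\<dots> = c ^ 3 * (Q ^ 3 * exp (Q / 16))" by (simp add: power_mult_distrib)
  also have "\<dots> \<le> c ^ 3 * ((110592 * exp (Q / 16)) * exp (Q / 16))"
    using c by (intro mult_left_mono mult_right_mono e1) auto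
  also have "\<dots> = 110592 * c ^ 3 * exp (Q / 8)"
    by (simp add: exp_add[symmetric])
  finally have b1: "\<bar>exp \<theta> - 1 - \<theta> - \<theta>\<^sup>2 / 2\<bar> \<le> 110592 * c ^ 3 * exp (Q / 8)" .
  have "\<theta>\<^sup>2 / 2 - (w * (c * p))\<^sup>2 / 2 = w\<^sup>2 * c ^ 3 * ((c * Q\<^sup>2 - 4 * (p * Q)) / 8)"
    unfolding \<theta> by (simp add: power2_eq_square power3_eq_cube field_simps)
  also have "\<bar>\<dots>\<bar> \<le> 4 * c ^ 3 * Q\<^sup>2"
  proof -
    have "\<bar>p * Q\<bar> \<le> Q\<^sup>2 / 2" using mult_right_mono[OF p Q0] Q0 by (simp add: abs_mult power2_eq_square)
    moreover have "\<bar>c * Q\<^sup>2\<bar> \<le> Q\<^sup>2" using c by (simp add: abs_mult mult_left_le_one_le)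
    ultimately have "\<bar>(c * Q\<^sup>2 - 4 * (p * Q)) / 8\<bar> \<le> Q\<^sup>2"
      by (simp only: abs_le_iff) (simp add: field_simps)
    moreover have "w\<^sup>2 \<le> 2\<^sup>2" using w by (intro power_mono) auto
    ultimately have "w\<^sup>2 * c ^ 3 * \<bar>(c * Q\<^sup>2 - 4 * (p * Q)) / 8\<bar> \<le> 2\<^sup>2 * c ^ 3 * Q\<^sup>2"
      using c by (intro mult_mono) auto
    then show ?thesis using c by (simp add: abs_mult)
  qed
  also have "\<dots> \<le> 4 * c ^ 3 * (1024 * exp (Q / 8))"
    using e2 Q0 c by (intro mult_left_mono) (auto intro: order_trans)
  finally have b2: "\<bar>\<theta>\<^sup>2 / 2 - (w * (c * p))\<^sup>2 / 2\<bar> \<le> 4096 * c ^ 3 * exp (Q / 8)" by simp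
  have "\<bar>exp \<theta> - (1 + \<theta> + (w * (c * p))\<^sup>2 / 2)\<bar> \<le> 114688 * (c ^ 3 * exp (Q / 8))"
    using b1 b2 by linarith
  also have "\<dots> \<le> 120000 * (c ^ 3 * exp (Q / 8))"
    using c by (intro mult_right_mono) auto
  finally show ?thesis
    by (simp add: \<theta>_def w_def p_def)
qed

lemma L2_gaussian_exp_bound:
  fixes f :: "real ^ 'd \<Rightarrow> real"
  assumes [measurable]: "f \<in> borel_measurable borel" and b: "\<And>y. \<bar>f y\<bar> \<le> C * exp ((norm y)\<^sup>2 / 8)"
  shows "f \<in> L2_space std_gaussian"
proof (rule L2_spaceI)
  show "integrable std_gaussian (\<lambda>y. (f y)\<^sup>2)"
  proof (rule Bochner_Integration.integrable_bound)
    show "integrable std_gaussian (\<lambda>y :: real ^ 'd. C\<^sup>2 * exp ((norm y)\<^sup>2 / 4))"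
      by (intro integrable_mult_right integrable_exp_square_gaussian)
    have "(f y)\<^sup>2 \<le> C\<^sup>2 * exp ((norm y)\<^sup>2 / 4)" for y
    proof -
      have "\<bar>f y\<bar>\<^sup>2 \<le> (C * exp ((norm y)\<^sup>2 / 8))\<^sup>2" using b by (intro power_mono) auto
      then show ?thesis by (simp add: power_mult_distrib exp_of_nat_mult[symmetric])
    qed
    then show "AE y in std_gaussian. norm ((f y)\<^sup>2) \<le> norm (C\<^sup>2 * exp ((norm y)\<^sup>2 / 4))"
      by (auto simp: abs_mult)
  qed measurable
qed measurable

lemma norm_square_le_exp: "(t :: real)\<^sup>2 \<le> 8 * exp (t\<^sup>2 / 8)" "1 \<le> exp (t\<^sup>2 / 8)"
  using exp_ge_add_one_self[of "t\<^sup>2 / 8"] zero_le_power2[of t] by (linarith+)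

lemma L2_gaussian_inner: "(\<lambda>y. v \<bullet> y) \<in> L2_space (std_gaussian :: (real ^ 'd) measure)"
proof (rule L2_gaussian_exp_bound)
  fix y
  have "\<bar>v \<bullet> y\<bar> \<le> norm v * norm y" by (rule Cauchy_Schwarz_ineq2)
  also have "\<dots> \<le> norm v * (9 * exp ((norm y)\<^sup>2 / 8))"
  proof (rule mult_left_mono)
    have "norm y \<le> 1 + (norm y)\<^sup>2" using sum_squares_bound[of 1 "norm y"] norm_ge_zero[of y]
      by (simp del: norm_ge_zero)
    then show "norm y \<le> 9 * exp ((norm y)\<^sup>2 / 8)" using norm_square_le_exp[of "norm y"] by linarith
  qed simp
  finally show "\<bar>v \<bullet> y\<bar> \<le> norm v * 9 * exp ((norm y)\<^sup>2 / 8)" by simp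
qed simp

lemma L2_gaussian_inner_square: "(\<lambda>y. (v \<bullet> y)\<^sup>2) \<in> L2_space (std_gaussian :: (real ^ 'd) measure)"
proof (rule L2_gaussian_exp_bound)
  fix y
  have "\<bar>v \<bullet> y\<bar>\<^sup>2 \<le> (norm v * norm y)\<^sup>2" by (intro power_mono Cauchy_Schwarz_ineq2) auto
  also have "\<dots> \<le> (norm v)\<^sup>2 * (8 * exp ((norm y)\<^sup>2 / 8))"
    unfolding power_mult_distrib by (intro mult_left_mono norm_square_le_exp) auto
  finally show "\<bar>(v \<bullet> y)\<^sup>2\<bar> \<le> (norm v)\<^sup>2 * 8 * exp ((norm y)\<^sup>2 / 8)" by simp
qed simp

text \<open>
  The part of the kernel that is polynomial of degree two in \<open>y\<close> integrates to zero against \<open>h\<close>, which leaves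
  the remainder of order \<open>c\<^sup>3\<close>. The constant depends on \<open>h\<close> in an uncontrolled way; \<open>doubling_bootstrap\<close> removes it.
\<close>
lemma ou_asymptotics:
  fixes h :: "real ^ 'd \<Rightarrow> real"
  assumes h: "h \<in> L2_space std_gaussian"
    and m0: "(\<integral>y. h y \<partial>std_gaussian) = 0"
    and m1: "\<And>v. (\<integral>y. h y * (v \<bullet> y) \<partial>std_gaussian) = 0"
    and m2: "\<And>v. (\<integral>y. h y * (v \<bullet> y)\<^sup>2 \<partial>std_gaussian) = 0"
  obtains C where "\<And>c. 0 < c \<Longrightarrow> c \<le> 1 / 16 \<Longrightarrow> (\<integral>x. (ou c h x)\<^sup>2 \<partial>std_gaussian) \<le> C * c ^ 6"
proof
  have [measurable]: "h \<in> borel_measurable borel"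
    using h by (rule L2_gaussian_measurable)
  have eL2: "(\<lambda>y :: real ^ 'd. exp ((norm y)\<^sup>2 / 8)) \<in> L2_space std_gaussian"
    by (rule L2_gaussian_exp_bound[where C=1]) auto
  have absh: "(\<lambda>y. \<bar>h y\<bar>) \<in> L2_space std_gaussian"
    using L2_integrable_square[OF h] by (intro L2_spaceI) auto
  define B where "B = (\<integral>y. \<bar>h y\<bar> * exp ((norm y)\<^sup>2 / 8) \<partial>std_gaussian)"
  have iB: "integrable std_gaussian (\<lambda>y. \<bar>h y\<bar> * exp ((norm y)\<^sup>2 / 8))"
    by (rule L2_integrable_mult[OF absh eL2])
  define D where "D = 2 ^ CARD('d) * (120000 * B)"
  have nsq: "(norm y)\<^sup>2 = (\<Sum>b\<in>Basis. (b \<bullet> y)\<^sup>2)" for y :: "real ^ 'd"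
    unfolding norm_square_Basis by (simp add: inner_commute)
  have i0: "integrable std_gaussian h"
    by (rule L2_integrable[OF gauss.finite_measure_axioms h])
  have i1: "integrable std_gaussian (\<lambda>y. h y * (v \<bullet> y))" for v
    by (rule L2_integrable_mult[OF h L2_gaussian_inner])
  have i2: "integrable std_gaussian (\<lambda>y. h y * (v \<bullet> y)\<^sup>2)" for v
    by (rule L2_integrable_mult[OF h L2_gaussian_inner_square])
  have i3: "integrable std_gaussian (\<lambda>y. h y * (norm y)\<^sup>2)"
    and m3: "(\<integral>y. h y * (norm y)\<^sup>2 \<partial>std_gaussian) = 0"
    unfolding nsq sum_distrib_left using i2 m2 by (simp_all add: Bochner_Integration.integral_sum)
  fix c :: real assume c: "0 < c" "c \<le> 1 / 16"
  then have c1: "c < 1" by simp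
  have pt: "\<bar>ou c h x\<bar> \<le> D * c ^ 3 * exp ((norm x)\<^sup>2 / 8)" for x
  proof -
    define E where "E = (1 / sqrt (1 - c\<^sup>2)) ^ CARD('d)"
    define w where "w = 1 / (1 - c\<^sup>2)"
    let ?\<theta> = "mehler_exponent c x"
    have [measurable]: "?\<theta> \<in> borel_measurable borel"
      unfolding mehler_exponent_def[abs_def] by measurable
    define T where "T y = 1 + ?\<theta> y + (c * (x \<bullet> y) / (1 - c\<^sup>2))\<^sup>2 / 2" for y
    have [measurable]: "T \<in> borel_measurable borel"
      unfolding T_def[abs_def] by measurable
    have c2: "c\<^sup>2 \<le> 3/4" using power_mono[OF c(2), of 2] c by (simp add: power2_eq_square)
    have E: "0 \<le> E" "E \<le> 2 ^ CARD('d)"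
    proof -
      have "sqrt (1/4) \<le> sqrt (1 - c\<^sup>2)" using c2 by (intro real_sqrt_le_mono) simp
      then have "1/2 \<le> sqrt (1 - c\<^sup>2)" by (simp add: real_sqrt_divide)
      then have "1 / sqrt (1 - c\<^sup>2) \<le> 2" "0 \<le> 1 / sqrt (1 - c\<^sup>2)" using c2 by (simp_all add: divide_le_eq mult.commute)
      then show "0 \<le> E" "E \<le> 2 ^ CARD('d)" unfolding E_def by (auto intro!: power_mono)
    qed
    have hT: "h y * T y = (1 - w * c\<^sup>2 * (norm x)\<^sup>2 / 2) * h y + (w * c) * (h y * (x \<bullet> y))
        + (- w * c\<^sup>2 / 2) * (h y * (norm y)\<^sup>2) + ((w * c)\<^sup>2 / 2) * (h y * (x \<bullet> y)\<^sup>2)" for y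
    proof -
      have "?\<theta> y = w * c * (x \<bullet> y) - w * c\<^sup>2 * (norm x)\<^sup>2 / 2 - w * c\<^sup>2 * (norm y)\<^sup>2 / 2"
      proof -
        have "?\<theta> y = w * ((2 * c * (x \<bullet> y) - c\<^sup>2 * ((norm x)\<^sup>2 + (norm y)\<^sup>2)) / 2)"
          by (simp add: mehler_exponent_def w_def)
        then show ?thesis by (simp add: field_simps)
      qed
      moreover have "c * (x \<bullet> y) / (1 - c\<^sup>2) = w * c * (x \<bullet> y)"
        by (simp add: w_def)
      ultimately have Ty: "T y = 1 + (w * c * (x \<bullet> y) - w * c\<^sup>2 * (norm x)\<^sup>2 / 2 - w * c\<^sup>2 * (norm y)\<^sup>2 / 2) +
          (w * c * (x \<bullet> y))\<^sup>2 / 2"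
        by (simp only: T_def)
      show ?thesis unfolding Ty by (simp add: power_mult_distrib algebra_simps)
    qed
    have iT: "integrable std_gaussian (\<lambda>y. h y * T y)"
      unfolding hT by (intro Bochner_Integration.integrable_add integrable_mult_right i0 i1 i2 i3)
    have mT: "(\<integral>y. h y * T y \<partial>std_gaussian) = 0"
      unfolding hT by (simp add: i0 i1 i2 i3 m0 m1 m2 m3)
    have rem: "\<bar>exp (?\<theta> y) - T y\<bar> \<le> 120000 * c ^ 3 * exp ((norm x)\<^sup>2 / 8) * exp ((norm y)\<^sup>2 / 8)" for y
      using mehler_remainder[OF c, of x y] by (simp add: T_def exp_add add_divide_distrib)
    have bnd: "\<bar>h y * (exp (?\<theta> y) - T y)\<bar> \<le>
        120000 * c ^ 3 * exp ((norm x)\<^sup>2 / 8) * (\<bar>h y\<bar> * exp ((norm y)\<^sup>2 / 8))" for y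
      using mult_left_mono[OF rem[of y] abs_ge_zero[of "h y"]] by (simp add: abs_mult mult_ac)
    have iR: "integrable std_gaussian (\<lambda>y. h y * (exp (?\<theta> y) - T y))"
      by (rule Bochner_Integration.integrable_bound[OF integrable_mult_right[OF iB,
          of "120000 * c ^ 3 * exp ((norm x)\<^sup>2 / 8)"]]) (use bnd c in \<open>auto simp: abs_mult\<close>)
    have "(\<integral>y. h y * exp (?\<theta> y) \<partial>std_gaussian) = (\<integral>y. h y * (exp (?\<theta> y) - T y) + h y * T y \<partial>std_gaussian)"
      by (simp add: algebra_simps)
    also have "\<dots> = (\<integral>y. h y * (exp (?\<theta> y) - T y) \<partial>std_gaussian)"
      by (subst Bochner_Integration.integral_add[OF iR iT]) (simp add: mT)
    finally have "\<bar>ou c h x\<bar> = E * \<bar>\<integral>y. h y * (exp (?\<theta> y) - T y) \<partial>std_gaussian\<bar>"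
      using E ou_kernel[OF c(1) c1, of h x] by (simp add: E_def abs_mult)
    also have "\<dots> \<le> 2 ^ CARD('d) * (120000 * c ^ 3 * exp ((norm x)\<^sup>2 / 8) * B)"
    proof (rule mult_mono)
      have "\<bar>\<integral>y. h y * (exp (?\<theta> y) - T y) \<partial>std_gaussian\<bar> \<le> (\<integral>y. \<bar>h y * (exp (?\<theta> y) - T y)\<bar> \<partial>std_gaussian)"
        by (rule integral_abs_bound)
      also have "\<dots> \<le> (\<integral>y. 120000 * c ^ 3 * exp ((norm x)\<^sup>2 / 8) * (\<bar>h y\<bar> * exp ((norm y)\<^sup>2 / 8)) \<partial>std_gaussian)"
        by (intro integral_mono integrable_abs iR integrable_mult_right iB bnd)
      finally show "\<bar>\<integral>y. h y * (exp (?\<theta> y) - T y) \<partial>std_gaussian\<bar> \<le>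
          120000 * c ^ 3 * exp ((norm x)\<^sup>2 / 8) * B"
        by (simp add: B_def)
    qed (use E in auto)
    finally show ?thesis by (simp add: D_def mult_ac)
  qed
  show "(\<integral>x. (ou c h x)\<^sup>2 \<partial>std_gaussian) \<le>
      (D\<^sup>2 * (\<integral>x. exp ((norm (x :: real ^ 'd))\<^sup>2 / 4) \<partial>std_gaussian)) * c ^ 6"
  proof -
    have "(\<integral>x. (ou c h x)\<^sup>2 \<partial>std_gaussian) \<le> (\<integral>x. D\<^sup>2 * c ^ 6 * exp ((norm (x :: real ^ 'd))\<^sup>2 / 4) \<partial>std_gaussian)"
    proof (rule integral_mono)
      show "integrable std_gaussian (\<lambda>x. (ou c h x)\<^sup>2)"
        by (rule L2_integrable_square[OF ou_L2[OF c(1) c1 h]])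
      show "integrable std_gaussian (\<lambda>x :: real ^ 'd. D\<^sup>2 * c ^ 6 * exp ((norm x)\<^sup>2 / 4))"
        by (intro integrable_mult_right integrable_exp_square_gaussian)
      fix x
      have "\<bar>ou c h x\<bar>\<^sup>2 \<le> (D * c ^ 3 * exp ((norm x)\<^sup>2 / 8))\<^sup>2"
        using pt by (intro power_mono) auto
      then show "(ou c h x)\<^sup>2 \<le> D\<^sup>2 * c ^ 6 * exp ((norm x)\<^sup>2 / 4)"
        by (simp add: power_mult_distrib exp_of_nat_mult[symmetric] power_mult[symmetric])
    qed
    then show ?thesis by (simp add: mult_ac)
  qed
qed

text \<open>
  If \<open>A c = b H c\<^sup>m\<close> with \<open>b > 1\<close>, then the doubling inequality propagates this as
  \<open>A (c\<^sup>N) \<ge> b\<^sup>N H c\<^bsup>N m\<^esup>\<close> for \<open>N = 2\<^sup>k\<close>, and the unbounded factor \<open>b\<^sup>N\<close> contradicts the bound by \<open>C\<close> for small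
  arguments.
\<close>
lemma doubling_bootstrap:
  fixes A :: "real \<Rightarrow> real"
  assumes c: "0 < c" "c < 1" and H: "0 \<le> H"
    and dbl: "\<And>c. 0 < c \<Longrightarrow> c < 1 \<Longrightarrow> (A c)\<^sup>2 \<le> H * A (c\<^sup>2)"
    and asy: "\<And>c. 0 < c \<Longrightarrow> c \<le> \<epsilon> \<Longrightarrow> A c \<le> C * c ^ m" and \<epsilon>: "0 < \<epsilon>"
  shows "A c \<le> H * c ^ m"
proof (rule ccontr)
  assume "\<not> A c \<le> H * c ^ m"
  then have gt: "A c > H * c ^ m" by simp
  have "0 \<le> H * c ^ m" using H c by simp
  then have Ac: "A c > 0" using gt by linarith
  have Hpos: "H > 0"
    using dbl[OF c] Ac H by (cases "H = 0") auto
  define b where "b = A c / (H * c ^ m)"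
  have b: "b > 1" using gt Hpos c by (simp add: b_def)
  have step: "H * (b * c ^ m) ^ (2 ^ k) \<le> A (c ^ (2 ^ k))" for k
  proof (induction k)
    case 0
    show ?case using Hpos c by (simp add: b_def)
  next
    case (Suc k)
    have ck: "0 < c ^ (2 ^ k)" "c ^ (2 ^ k) < 1" using c by (auto simp: power_less_one_iff)
    have "(H * (b * c ^ m) ^ (2 ^ k))\<^sup>2 \<le> (A (c ^ (2 ^ k)))\<^sup>2"
      using Suc Hpos b c by (intro power_mono) auto
    also have "\<dots> \<le> H * A ((c ^ (2 ^ k))\<^sup>2)" by (rule dbl[OF ck])
    finally have "H * (H * ((b * c ^ m) ^ (2 ^ k))\<^sup>2) \<le> H * A ((c ^ (2 ^ k))\<^sup>2)"
      by (simp add: power_mult_distrib power2_eq_square mult_ac)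
    then have "H * ((b * c ^ m) ^ (2 ^ k))\<^sup>2 \<le> A ((c ^ (2 ^ k))\<^sup>2)"
      using Hpos by simp
    then show ?case by (simp add: power_mult[symmetric] mult.commute)
  qed
  have "(\<lambda>n. c ^ n) \<longlonglongrightarrow> 0" using c by (intro LIMSEQ_power_zero) auto
  then have "eventually (\<lambda>n. c ^ n < \<epsilon>) sequentially" using \<epsilon> by (rule order_tendstoD)
  moreover have "eventually (\<lambda>n. C / H < b ^ n) sequentially"
    using real_arch_pow[OF b, of "C / H"] power_increasing[of _ _ b] b
    unfolding eventually_sequentially by (meson less_le_trans less_imp_le)
  ultimately obtain N where N: "\<And>n. n \<ge> N \<Longrightarrow> c ^ n < \<epsilon> \<and> C / H < b ^ n"
    unfolding eventually_sequentially by (metis linorder_le_cases order_trans)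
  have "N \<le> 2 ^ N" using less_exp[of N] by simp
  from N[OF this] have n: "c ^ (2 ^ N) \<le> \<epsilon>" "C < H * b ^ (2 ^ N)"
    using Hpos by (auto simp: field_simps)
  have "H * b ^ (2 ^ N) * (c ^ (2 ^ N)) ^ m \<le> A (c ^ (2 ^ N))"
    using step[of N] by (simp add: power_mult_distrib power_mult[symmetric] mult_ac)
  also have "\<dots> \<le> C * (c ^ (2 ^ N)) ^ m" using n c by (intro asy) auto
  finally show False using n(2) c by simp
qed

lemma ou_third_order_contraction:
  fixes h :: "real ^ 'd \<Rightarrow> real"
  assumes c: "0 < c" "c < 1" and h: "h \<in> L2_space std_gaussian"
    and "(\<integral>y. h y \<partial>std_gaussian) = 0"
    and "\<And>v. (\<integral>y. h y * (v \<bullet> y) \<partial>std_gaussian) = 0"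
    and "\<And>v. (\<integral>y. h y * (v \<bullet> y)\<^sup>2 \<partial>std_gaussian) = 0"
  shows "(\<integral>x. (ou c h x)\<^sup>2 \<partial>std_gaussian) \<le> (\<integral>x. (h x)\<^sup>2 \<partial>std_gaussian) * c ^ 6"
proof -
  obtain C where C: "\<And>c. 0 < c \<Longrightarrow> c \<le> 1 / 16 \<Longrightarrow> (\<integral>x. (ou c h x)\<^sup>2 \<partial>std_gaussian) \<le> C * c ^ 6"
    using ou_asymptotics[OF h assms(4-6)] by blast
  show ?thesis
    by (rule doubling_bootstrap[where A="\<lambda>c. \<integral>x. (ou c h x)\<^sup>2 \<partial>std_gaussian" and \<epsilon>="1/16" and C=C])
       (use c ou_doubling[OF _ _ h] C in auto)
qed

section \<open>Total variation under scaling and convolution\<close>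

definition borel_prob :: "(real ^ 'd) measure \<Rightarrow> bool" where
  "borel_prob P \<longleftrightarrow> prob_space P \<and> sets P = sets borel"

lemma borel_probD:
  assumes "borel_prob P"
  shows "prob_space P" "finite_measure P" "sets P = sets borel" "space P = UNIV"
  using assms sets_eq_imp_space_eq[of P borel]
  by (auto simp: borel_prob_def intro: prob_space.finite_measure)

lemma borel_prob_gauss_law: "borel_prob (gauss_law s)"
  by (simp add: borel_prob_def prob_space_gauss_law)

lemma borel_prob_std_gaussian: "borel_prob std_gaussian"
  by (simp add: borel_prob_def prob_space_std_gaussian)

lemma borel_prob_return: "borel_prob (return borel x)"
  by (simp add: borel_prob_def prob_space_return)

lemma borel_prob_scale:
  assumes "borel_prob P"
  shows "borel_prob (distr P borel (\<lambda>x. a *\<^sub>R x))"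
proof -
  have [measurable_cong]: "sets P = sets borel" using assms by (rule borel_probD)
  show ?thesis
    using assms by (auto simp: borel_prob_def intro!: prob_space.prob_space_distr)
qed

lemma borel_prob_convolution:
  fixes P Q :: "(real ^ 'd) measure"
  assumes "borel_prob P" "borel_prob Q"
  shows "borel_prob (P \<star> Q)"
proof -
  interpret P: prob_space P using assms(1) by (rule borel_probD)
  interpret Q: prob_space Q using assms(2) by (rule borel_probD)
  interpret PQ: pair_prob_space P Q ..
  note [measurable_cong] = borel_probD(3)[OF assms(1)] borel_probD(3)[OF assms(2)]
  show ?thesis
    unfolding borel_prob_def convolution_def by (auto intro!: PQ.prob_space_distr)
qed

lemma borel_prob_convolution_assoc:
  assumes "borel_prob P" "borel_prob Q" "borel_prob R"
  shows "((P \<star> Q) \<star> R) = (P \<star> (Q \<star> R))"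
  using assms[THEN borel_probD(2)] assms[THEN borel_probD(3)]
  by (intro convolution_associative[symmetric]) auto

lemma borel_prob_convolution_commute:
  assumes "borel_prob P" "borel_prob Q"
  shows "(P \<star> Q) = (Q \<star> P)"
  using assms[THEN borel_probD(2)] assms[THEN borel_probD(3)]
  by (intro convolution_commutative) auto

lemma convolution_scale:
  fixes P Q :: "(real ^ 'd) measure"
  assumes "borel_prob P" "borel_prob Q"
  shows "distr (P \<star> Q) borel (\<lambda>x. a *\<^sub>R x) =
    (distr P borel (\<lambda>x. a *\<^sub>R x) \<star> distr Q borel (\<lambda>x. a *\<^sub>R x))"
proof -
  note [measurable_cong] = borel_probD(3)[OF assms(1)] borel_probD(3)[OF assms(2)]
  show ?thesis
    using assms by (subst convolution_scaled)
      (auto simp: convolution_def distr_distr scaleR_add_right borel_probD intro!: distr_cong)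
qed

lemma gauss_law_scale: "distr (gauss_law s) borel (\<lambda>x. a *\<^sub>R x) = gauss_law (a * s)"
  unfolding gauss_law_def by (subst distr_distr) (auto simp: o_def)

text \<open>Total variation at most \<open>\<epsilon>\<close>, in a form that passes through image measures and convolutions one set at a time.\<close>
definition tv_le :: "(real ^ 'd) measure \<Rightarrow> (real ^ 'd) measure \<Rightarrow> real \<Rightarrow> bool" where
  "tv_le P Q \<epsilon> \<longleftrightarrow> (\<forall>A\<in>sets borel. \<bar>measure P A - measure Q A\<bar> \<le> \<epsilon>)"

lemma tv_le_trans:
  fixes P Q R :: "(real ^ 'd) measure"
  assumes "tv_le P Q \<epsilon>" "tv_le Q R \<delta>"
  shows "tv_le P R (\<epsilon> + \<delta>)"
  unfolding tv_le_def
proof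
  fix A :: "(real ^ 'd) set" assume A: "A \<in> sets borel"
  have "\<bar>measure P A - measure Q A\<bar> \<le> \<epsilon>" "\<bar>measure Q A - measure R A\<bar> \<le> \<delta>"
    using assms A by (auto simp: tv_le_def)
  then show "\<bar>measure P A - measure R A\<bar> \<le> \<epsilon> + \<delta>" by linarith
qed

lemma tv_le_scale:
  fixes P Q :: "(real ^ 'd) measure"
  assumes "borel_prob P" "borel_prob Q" "tv_le P Q \<epsilon>"
  shows "tv_le (distr P borel (\<lambda>x. a *\<^sub>R x)) (distr Q borel (\<lambda>x. a *\<^sub>R x)) \<epsilon>"
  unfolding tv_le_def
proof
  note s = borel_probD(3)[OF assms(1)] borel_probD(3)[OF assms(2)]
  note sp = borel_probD(4)[OF assms(1)] borel_probD(4)[OF assms(2)]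
  note [measurable_cong] = s
  fix A :: "(real ^ 'd) set" assume A[measurable]: "A \<in> sets borel"
  have "(\<lambda>x. a *\<^sub>R x) -` A \<inter> space (borel :: (real ^ 'd) measure) \<in> sets borel" by measurable
  then have "(\<lambda>x. a *\<^sub>R x) -` A \<in> sets borel" by simp
  then show "\<bar>measure (distr P borel (\<lambda>x. a *\<^sub>R x)) A - measure (distr Q borel (\<lambda>x. a *\<^sub>R x)) A\<bar> \<le> \<epsilon>"
    using assms(3) by (simp add: measure_distr sp tv_le_def)
qed

lemma measure_convolution:
  fixes P Q :: "(real ^ 'd) measure"
  assumes P: "borel_prob P" and Q: "borel_prob Q" and A[measurable]: "A \<in> sets borel"
  shows "measure (P \<star> Q) A = (\<integral>x. measure Q {y. x + y \<in> A} \<partial>P)"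
    and "integrable P (\<lambda>x. measure Q {y. x + y \<in> A})"
proof -
  interpret P: prob_space P using P by (rule borel_probD)
  interpret Q: prob_space Q using Q by (rule borel_probD)
  interpret PQ: pair_prob_space P Q ..
  note [measurable_cong] = borel_probD(3)[OF P] borel_probD(3)[OF Q]
  have i: "integrable (P \<Otimes>\<^sub>M Q) (\<lambda>(x, y). indicat_real A (x + y))"
    by (rule PQ.integrable_const_bound[where B=1]) (auto simp: indicator_def)
  have m: "measure Q {y. x + y \<in> A} = (\<integral>y. indicat_real A (x + y) \<partial>Q)" for x
  proof -
    have "(\<integral>y. indicat_real A (x + y) \<partial>Q) = (\<integral>y. indicat_real {y. x + y \<in> A} y \<partial>Q)"
      by (intro Bochner_Integration.integral_cong) (auto simp: indicator_def)
    then show ?thesis using borel_probD(4)[OF Q] by simp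
  qed
  show "integrable P (\<lambda>x. measure Q {y. x + y \<in> A})"
    using PQ.integrable_fst'[OF i] by (simp add: m)
  have "measure (P \<star> Q) A = (\<integral>x. indicat_real A x \<partial>(P \<star> Q))"
    by (simp add: convolution_def)
  also have "\<dots> = (\<integral>p. (case p of (x, y) \<Rightarrow> indicat_real A (x + y)) \<partial>(P \<Otimes>\<^sub>M Q))"
    unfolding convolution_def by (subst integral_distr) (auto simp: case_prod_beta')
  also have "\<dots> = (\<integral>x. \<integral>y. indicat_real A (x + y) \<partial>Q \<partial>P)"
    using PQ.integral_fst'[OF i] by simp
  finally show "measure (P \<star> Q) A = (\<integral>x. measure Q {y. x + y \<in> A} \<partial>P)"
    by (simp add: m)
qed

lemma tv_le_convolution:
  fixes P Q R :: "(real ^ 'd) measure"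
  assumes P: "borel_prob P" and Q: "borel_prob Q" and R: "borel_prob R" and tv: "tv_le Q R \<epsilon>"
  shows "tv_le (P \<star> Q) (P \<star> R) \<epsilon>"
  unfolding tv_le_def
proof
  interpret P: prob_space P using P by (rule borel_probD)
  fix A :: "(real ^ 'd) set" assume A[measurable]: "A \<in> sets borel"
  have le: "\<bar>measure Q {y. x + y \<in> A} - measure R {y. x + y \<in> A}\<bar> \<le> \<epsilon>" for x
  proof -
    have "(\<lambda>y. x + y) -` A \<inter> space (borel :: (real ^ 'd) measure) \<in> sets borel" by measurable
    then have "{y. x + y \<in> A} \<in> sets borel" by (simp add: vimage_def)
    then show ?thesis using tv by (simp add: tv_le_def)
  qed
  have i: "integrable P (\<lambda>x. measure Q {y. x + y \<in> A} - measure R {y. x + y \<in> A})"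
    by (intro Bochner_Integration.integrable_diff measure_convolution P Q R A)
  have "\<bar>measure (P \<star> Q) A - measure (P \<star> R) A\<bar> =
      \<bar>\<integral>x. measure Q {y. x + y \<in> A} - measure R {y. x + y \<in> A} \<partial>P\<bar>"
    by (simp add: measure_convolution[OF P _ A] Q R)
  also have "\<dots> \<le> (\<integral>x. \<bar>measure Q {y. x + y \<in> A} - measure R {y. x + y \<in> A}\<bar> \<partial>P)"
    by (rule integral_abs_bound)
  also have "\<dots> \<le> (\<integral>x. \<epsilon> \<partial>P)"
    by (intro integral_mono integrable_abs i le) auto
  also have "\<dots> = \<epsilon>" by (simp add: P.prob_space)
  finally show "\<bar>measure (P \<star> Q) A - measure (P \<star> R) A\<bar> \<le> \<epsilon>" .
qed

text \<open>
  Testing \<open>p - 1\<close>, which has mean zero, against \<open>2 * indicator A - 1\<close> gives twice the difference of the two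
  measures of \<open>A\<close>. The test function has modulus one, so Cauchy-Schwarz produces the factor \<open>1/2\<close> directly.
\<close>
lemma tv_le_density_gaussian:
  fixes p :: "real ^ 'd \<Rightarrow> real"
  assumes p: "p \<in> L2_space std_gaussian" and p0: "\<And>x. 0 \<le> p x" and p1: "(\<integral>x. p x \<partial>std_gaussian) = 1"
  shows "tv_le (density std_gaussian (\<lambda>x. ennreal (p x))) std_gaussian
     (sqrt (\<integral>x. (p x - 1)\<^sup>2 \<partial>std_gaussian) / 2)"
  unfolding tv_le_def
proof
  fix A :: "(real ^ 'd) set" assume A[measurable]: "A \<in> sets borel"
  let ?\<sigma> = "\<lambda>x. 2 * indicat_real A x - 1"
  have [measurable]: "p \<in> borel_measurable borel"
    using p by (rule L2_gaussian_measurable)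
  note fin = gauss.finite_measure_axioms[where 'd='d]
  have ip: "integrable std_gaussian p" by (rule L2_integrable[OF fin p])
  have one: "(\<lambda>_. 1) \<in> L2_space (std_gaussian :: (real ^ 'd) measure)"
    by (rule L2_bounded[OF fin, of _ 1]) auto
  have A2: "indicat_real A \<in> L2_space std_gaussian"
    by (rule L2_bounded[OF fin, of _ 1]) (auto simp: indicator_def)
  have q: "(\<lambda>x. p x - 1) \<in> L2_space std_gaussian" by (rule L2_diff[OF p one])
  have \<sigma>: "?\<sigma> \<in> L2_space std_gaussian"
    by (rule L2_bounded[OF fin, of _ 1]) (auto simp: indicator_def)
  have sq: "(?\<sigma> x)\<^sup>2 = 1" for x by (simp add: indicator_def)
  have iA: "integrable std_gaussian (\<lambda>x. indicat_real A x * p x)"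
    and iA1: "integrable std_gaussian (indicat_real A)"
    using L2_integrable_mult[OF A2 p] L2_integrable[OF fin A2] by auto
  have "measure (density std_gaussian (\<lambda>x. ennreal (p x))) A =
      (\<integral>x. indicat_real A x * p x \<partial>std_gaussian)"
  proof -
    have "measure (density std_gaussian (\<lambda>x. ennreal (p x))) A =
        (\<integral>x. indicat_real A x \<partial>density std_gaussian (\<lambda>x. ennreal (p x)))"
      by simp
    also have "\<dots> = (\<integral>x. p x * indicat_real A x \<partial>std_gaussian)"
      using p0 by (subst integral_density) auto
    finally show ?thesis by (simp add: mult.commute)
  qed
  moreover have "measure std_gaussian A = (\<integral>x. indicat_real A x \<partial>std_gaussian)" by simp
  moreover have "(\<integral>x. ?\<sigma> x * (p x - 1) \<partial>std_gaussian) =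
      (\<integral>x. 2 * (indicat_real A x * p x) - 2 * indicat_real A x - p x + 1 \<partial>std_gaussian)"
    by (intro Bochner_Integration.integral_cong) (auto simp: algebra_simps)
  moreover have "\<dots> = 2 * (\<integral>x. indicat_real A x * p x \<partial>std_gaussian)
      - 2 * (\<integral>x. indicat_real A x \<partial>std_gaussian) - 1 + 1"
    using iA iA1 ip p1 gauss.prob_space[where 'd='d]
    by (simp del: integral_indicator Bochner_Integration.integral_indicator)
  ultimately have D: "measure (density std_gaussian (\<lambda>x. ennreal (p x))) A - measure std_gaussian A =
      (\<integral>x. ?\<sigma> x * (p x - 1) \<partial>std_gaussian) / 2"
    by simp
  have "(\<integral>x. ?\<sigma> x * (p x - 1) \<partial>std_gaussian)\<^sup>2 \<le> (\<integral>x. (p x - 1)\<^sup>2 \<partial>std_gaussian)"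
    using L2_Cauchy_Schwarz[OF \<sigma> q] gauss.prob_space[where 'd='d] by (simp only: sq) simp
  then have "\<bar>\<integral>x. ?\<sigma> x * (p x - 1) \<partial>std_gaussian\<bar> \<le> sqrt (\<integral>x. (p x - 1)\<^sup>2 \<partial>std_gaussian)"
    using real_le_rsqrt[of "\<bar>\<integral>x. ?\<sigma> x * (p x - 1) \<partial>std_gaussian\<bar>"] by simp
  then show "\<bar>measure (density std_gaussian (\<lambda>x. ennreal (p x))) A - measure std_gaussian A\<bar>
      \<le> sqrt (\<integral>x. (p x - 1)\<^sup>2 \<partial>std_gaussian) / 2"
    unfolding D by simp
qed

section \<open>Replacing the summands by Gaussian vectors\<close>

lemma borel_prob_density:
  fixes f :: "real ^ 'd \<Rightarrow> real"
  assumes "f \<in> L2_space std_gaussian" "\<And>x. 0 \<le> f x" "(\<integral>x. f x \<partial>std_gaussian) = 1"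
  shows "borel_prob (density std_gaussian (\<lambda>x. ennreal (f x)))"
proof -
  have [measurable]: "f \<in> borel_measurable borel"
    using assms(1) by (rule L2_gaussian_measurable)
  have "integrable std_gaussian f"
    by (rule L2_integrable[OF gauss.finite_measure_axioms assms(1)])
  from nn_integral_eq_integral[OF this] assms
  have "prob_space (density std_gaussian (\<lambda>x. ennreal (f x)))"
    by (intro prob_spaceI) (simp add: emeasure_density)
  then show ?thesis by (simp add: borel_prob_def)
qed

text \<open>
  A square-integrable probability density relative to the Gaussian measure whose law has mean zero and
  identity covariance. The covariance is recorded as a quadratic form.
\<close>
definition matches_gaussian_moments :: "(real ^ 'd \<Rightarrow> real) \<Rightarrow> bool" where
  "matches_gaussian_moments f \<longleftrightarrow> f \<in> L2_space std_gaussian \<and> (\<forall>x. 0 \<le> f x)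
     \<and> (\<integral>y. f y \<partial>std_gaussian) = 1
     \<and> (\<forall>v. (\<integral>y. f y * (v \<bullet> y) \<partial>std_gaussian) = 0)
     \<and> (\<forall>v. (\<integral>y. f y * (v \<bullet> y)\<^sup>2 \<partial>std_gaussian) = (norm v)\<^sup>2)"

lemma gaussian_first_moment: "(\<integral>x. v \<bullet> x \<partial>(std_gaussian :: (real ^ 'd) measure)) = 0"
proof -
  have "(\<integral>x. v \<bullet> x \<partial>(std_gaussian :: (real ^ 'd) measure)) = (\<integral>x. - (v \<bullet> x) \<partial>std_gaussian)"
    using integral_distr[of uminus std_gaussian std_gaussian "\<lambda>x :: real ^ 'd. v \<bullet> x"]
    by (simp add: distr_gaussian_uminus)
  then show ?thesis by simp
qed

text \<open>
  The moment conditions say that \<open>f - 1\<close> is orthogonal to the polynomials of degree at most two, and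
  \<open>ou c f - 1 = ou c (f - 1)\<close> almost everywhere.
\<close>
lemma tv_le_ou:
  fixes f :: "real ^ 'd \<Rightarrow> real"
  assumes f: "matches_gaussian_moments f" and c: "0 < c" "c < 1"
  shows "tv_le (density std_gaussian (\<lambda>x. ennreal (ou c f x))) std_gaussian
     (c ^ 3 * sqrt (\<integral>x. (f x - 1)\<^sup>2 \<partial>std_gaussian) / 2)"
proof -
  note fin = gauss.finite_measure_axioms[where 'd='d]
  have fL: "f \<in> L2_space std_gaussian" and f0: "\<And>x. 0 \<le> f x" and f1: "(\<integral>x. f x \<partial>std_gaussian) = 1"
    using f by (auto simp: matches_gaussian_moments_def)
  have if': "integrable std_gaussian f" by (rule L2_integrable[OF fin fL])
  define h where "h = (\<lambda>x. f x - 1)"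
  have one: "(\<lambda>_. 1) \<in> L2_space (std_gaussian :: (real ^ 'd) measure)"
    by (rule L2_bounded[OF fin, of _ 1]) auto
  have h: "h \<in> L2_space std_gaussian"
    unfolding h_def by (rule L2_diff[OF fL one])
  have h0: "(\<integral>y. h y \<partial>std_gaussian) = 0"
    using if' f1 gauss.prob_space[where 'd='d] by (simp add: h_def)
  have h1: "(\<integral>y. h y * (v \<bullet> y) \<partial>std_gaussian) = 0" for v
  proof -
    have "(\<integral>y. h y * (v \<bullet> y) \<partial>std_gaussian) = (\<integral>y. f y * (v \<bullet> y) - v \<bullet> y \<partial>std_gaussian)"
      by (simp add: h_def algebra_simps)
    also have "\<dots> = 0"
      using f L2_integrable_mult[OF fL L2_gaussian_inner] L2_integrable[OF fin L2_gaussian_inner]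
      by (subst Bochner_Integration.integral_diff)
        (auto simp: matches_gaussian_moments_def gaussian_first_moment simp del: integral_inner_right)
    finally show ?thesis .
  qed
  have h2: "(\<integral>y. h y * (v \<bullet> y)\<^sup>2 \<partial>std_gaussian) = 0" for v
  proof -
    have "(\<integral>y. h y * (v \<bullet> y)\<^sup>2 \<partial>std_gaussian) = (\<integral>y. f y * (v \<bullet> y)\<^sup>2 - (v \<bullet> y)\<^sup>2 \<partial>std_gaussian)"
      by (simp add: h_def algebra_simps)
    also have "\<dots> = 0"
      using f L2_integrable_mult[OF fL L2_gaussian_inner_square] L2_integrable[OF fin L2_gaussian_inner_square]
      by (subst Bochner_Integration.integral_diff)
        (auto simp: matches_gaussian_moments_def gaussian_second_moment)
    finally show ?thesis .
  qed
  have [measurable]: "f \<in> borel_measurable borel" "h \<in> borel_measurable borel"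
    using fL h by (auto dest: L2_gaussian_measurable)
  have "AE x in std_gaussian. ou c f x - 1 = ou c h x"
    using AE_integrable_ou[OF c if']
  proof eventually_elim
    case (elim x)
    then show ?case
      using gauss.prob_space[where 'd='d] by (simp add: ou_def h_def)
  qed
  then have "(\<integral>x. (ou c f x - 1)\<^sup>2 \<partial>std_gaussian) = (\<integral>x. (ou c h x)\<^sup>2 \<partial>std_gaussian)"
    by (intro integral_cong_AE) auto
  also have "\<dots> \<le> (\<integral>x. (h x)\<^sup>2 \<partial>std_gaussian) * (c ^ 3)\<^sup>2"
    using ou_third_order_contraction[OF c h h0 h1 h2] by (simp add: power_mult[symmetric])
  finally have le: "sqrt (\<integral>x. (ou c f x - 1)\<^sup>2 \<partial>std_gaussian) \<le> sqrt (\<integral>x. (h x)\<^sup>2 \<partial>std_gaussian) * c ^ 3"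
    using c by (metis real_sqrt_le_iff real_sqrt_mult real_sqrt_abs abs_of_nonneg zero_le_power less_imp_le)
  have "tv_le (density std_gaussian (\<lambda>x. ennreal (ou c f x))) std_gaussian
     (sqrt (\<integral>x. (ou c f x - 1)\<^sup>2 \<partial>std_gaussian) / 2)"
    using integral_ou(2)[OF c if'] f1
    by (intro tv_le_density_gaussian ou_L2 c fL) (auto simp: ou_def f0)
  then show ?thesis
    using le unfolding tv_le_def h_def by (auto simp: mult.commute intro: order_trans)
qed

fun conv_power :: "(real ^ 'd) measure \<Rightarrow> nat \<Rightarrow> (real ^ 'd) measure" where
  "conv_power V 0 = return borel 0"
| "conv_power V (Suc j) = (V \<star> conv_power V j)"

lemma borel_prob_conv_power: "borel_prob V \<Longrightarrow> borel_prob (conv_power V j)"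
  by (induction j) (auto simp: borel_prob_return borel_prob_convolution)

text \<open>
  One exchange. With \<open>t = sqrt (1 - \<alpha> j / n)\<close> and \<open>c = sqrt (\<alpha> / (n - \<alpha> j))\<close> one has \<open>t c = sqrt (\<alpha> / n)\<close> and
  \<open>t sqrt (1 - c\<^sup>2) = sqrt (1 - \<alpha> (j + 1) / n)\<close>, so scaling by \<open>t\<close> carries the pair of laws in \<open>tv_le_ou\<close> to
  the pair compared here.
\<close>
lemma lindeberg_step:
  fixes f :: "real ^ 'd \<Rightarrow> real" and n j :: nat and \<alpha> :: real
  assumes f: "matches_gaussian_moments f" and n: "j < n" and a: "0 < \<alpha>" "\<alpha> < 1"
  defines "V \<equiv> distr (density std_gaussian (\<lambda>x. ennreal (f x))) borel (\<lambda>x. sqrt (\<alpha> / n) *\<^sub>R x)"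
  shows "tv_le (V \<star> gauss_law (sqrt (1 - \<alpha> * Suc j / n))) (gauss_law (sqrt (1 - \<alpha> * j / n)))
    (sqrt (\<alpha> / (n - \<alpha> * j)) ^ 3 * sqrt (\<integral>x. (f x - 1)\<^sup>2 \<partial>std_gaussian) / 2)"
proof -
  let ?\<nu> = "density std_gaussian (\<lambda>x. ennreal (f x))"
  have fL: "f \<in> L2_space std_gaussian" and f0: "\<And>x. 0 \<le> f x" and f1: "(\<integral>x. f x \<partial>std_gaussian) = 1"
    using f by (auto simp: matches_gaussian_moments_def)
  define c where "c = sqrt (\<alpha> / (n - \<alpha> * j))"
  define t where "t = sqrt (1 - \<alpha> * j / n)"
  have "\<alpha> * Suc j \<le> \<alpha> * n" using n a by (intro mult_left_mono) auto
  moreover have "\<alpha> * n < n" using n a by simp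
  ultimately have lt: "\<alpha> < n - \<alpha> * j" by (simp add: algebra_simps)
  have npos: "real n > 0" using n by simp
  have c: "0 < c" "c < 1" using lt a by (auto simp: c_def)
  have t0: "0 \<le> t" unfolding t_def using lt a npos by (auto simp: field_simps)
  have c2: "c\<^sup>2 = \<alpha> / (n - \<alpha> * j)" using lt a by (simp add: c_def)
  have tc: "t * c = sqrt (\<alpha> / n)"
    unfolding t_def c_def real_sqrt_mult[symmetric] using lt a npos
    by (simp add: field_simps)
  have ts: "t * sqrt (1 - c\<^sup>2) = sqrt (1 - \<alpha> * Suc j / n)"
    unfolding t_def c2 real_sqrt_mult[symmetric] using lt a npos
    by (simp add: field_simps)
  have \<nu>: "borel_prob ?\<nu>" by (rule borel_prob_density[OF fL f0 f1])
  have d: "density std_gaussian (\<lambda>x. ennreal (ou c f x)) =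
      (distr ?\<nu> borel (\<lambda>x. c *\<^sub>R x) \<star> gauss_law (sqrt (1 - c\<^sup>2)))"
    by (rule density_ou[OF c fL f0])
  have [measurable_cong]: "sets ?\<nu> = sets borel" using \<nu> by (rule borel_probD)
  have "distr (density std_gaussian (\<lambda>x. ennreal (ou c f x))) borel (\<lambda>x. t *\<^sub>R x) =
      (V \<star> gauss_law (sqrt (1 - \<alpha> * Suc j / n)))"
    unfolding d
    by (simp add: convolution_scale borel_prob_scale \<nu> borel_prob_gauss_law gauss_law_scale ts
        distr_distr o_def V_def tc)
  moreover have "distr std_gaussian borel (\<lambda>x. t *\<^sub>R x) = (gauss_law t :: (real ^ 'd) measure)"
    by (simp add: gauss_law_def)
  moreover have "tv_le (distr (density std_gaussian (\<lambda>x. ennreal (ou c f x))) borel (\<lambda>x. t *\<^sub>R x))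
      (distr std_gaussian borel (\<lambda>x. t *\<^sub>R x)) (c ^ 3 * sqrt (\<integral>x. (f x - 1)\<^sup>2 \<partial>std_gaussian) / 2)"
    by (intro tv_le_scale tv_le_ou[OF f c] borel_prob_std_gaussian)
      (simp add: d borel_prob_convolution borel_prob_scale \<nu> borel_prob_gauss_law)
  ultimately show ?thesis
    unfolding c_def[symmetric] t_def[symmetric] by simp
qed

text \<open>
  The intermediate laws consist of \<open>j\<close> copies of \<open>sqrt (\<alpha> / n) Z\<close> and a Gaussian vector that fills up
  the variance to one. Consecutive laws share the first \<open>j\<close> copies, which convolve away.
\<close>
lemma lindeberg_telescope:
  fixes f :: "real ^ 'd \<Rightarrow> real" and n j :: nat and \<alpha> :: real
  assumes f: "matches_gaussian_moments f" and n: "0 < n" and a: "0 < \<alpha>" "\<alpha> < 1"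
  defines "V \<equiv> distr (density std_gaussian (\<lambda>x. ennreal (f x))) borel (\<lambda>x. sqrt (\<alpha> / n) *\<^sub>R x)"
  assumes j: "j \<le> n"
  shows "tv_le (conv_power V j \<star> gauss_law (sqrt (1 - \<alpha> * j / n))) std_gaussian
    (\<Sum>i<j. sqrt (\<alpha> / (n - \<alpha> * i)) ^ 3 * sqrt (\<integral>x. (f x - 1)\<^sup>2 \<partial>std_gaussian) / 2)"
  using j
proof (induction j)
  case 0
  show ?case
    by (simp add: convolution_return_0[OF prob_space_std_gaussian] gauss_law_1 tv_le_def)
next
  case (Suc j)
  let ?W = "conv_power V j"
  have V: "borel_prob V"
    unfolding V_def using f
    by (intro borel_prob_scale borel_prob_density) (auto simp: matches_gaussian_moments_def)
  have W: "borel_prob ?W" by (rule borel_prob_conv_power[OF V])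
  have "(conv_power V (Suc j) \<star> gauss_law (sqrt (1 - \<alpha> * Suc j / n))) =
      (?W \<star> (V \<star> gauss_law (sqrt (1 - \<alpha> * Suc j / n))))"
    by (simp add: borel_prob_convolution_commute[OF V W] borel_prob_convolution_assoc[OF W V borel_prob_gauss_law])
  moreover have "tv_le (?W \<star> (V \<star> gauss_law (sqrt (1 - \<alpha> * Suc j / n)))) (?W \<star> gauss_law (sqrt (1 - \<alpha> * j / n)))
      (sqrt (\<alpha> / (n - \<alpha> * j)) ^ 3 * sqrt (\<integral>x. (f x - 1)\<^sup>2 \<partial>std_gaussian) / 2)"
    using Suc.prems lindeberg_step[OF f _ a, of j n]
    by (intro tv_le_convolution W borel_prob_convolution V borel_prob_gauss_law) (auto simp: V_def)
  ultimately show ?case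
    using tv_le_trans[OF _ Suc.IH] Suc.prems by (simp add: add.commute)
qed

lemma lindeberg_sum:
  fixes n :: nat and \<alpha> :: real
  assumes n: "0 < n" and a: "0 < \<alpha>" "\<alpha> < 1"
  shows "(\<Sum>i<n. sqrt (\<alpha> / (n - \<alpha> * i)) ^ 3) \<le> (1 / sqrt n) * (\<alpha> / (1 - \<alpha>)) powr (3 / 2)"
proof -
  have npos: "real n > 0" using n by simp
  let ?q = "\<alpha> / (1 - \<alpha>)"
  have q: "?q > 0" using a by simp
  have "sqrt (\<alpha> / (n - \<alpha> * i)) ^ 3 \<le> sqrt (?q / n) ^ 3" if "i < n" for i
  proof -
    have "\<alpha> * i \<le> \<alpha> * n" using that a by simp
    then have "(1 - \<alpha>) * n \<le> n - \<alpha> * i" by (simp add: algebra_simps)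
    moreover have "0 < (1 - \<alpha>) * n" using a npos by simp
    ultimately have pos: "0 < n - \<alpha> * i" and "\<alpha> / (n - \<alpha> * i) \<le> \<alpha> / ((1 - \<alpha>) * n)"
      using a by (auto intro!: divide_left_mono mult_pos_pos)
    then show ?thesis using a
      by (intro power_mono real_sqrt_le_mono real_sqrt_ge_zero) auto
  qed
  then have "(\<Sum>i<n. sqrt (\<alpha> / (n - \<alpha> * i)) ^ 3) \<le> n * sqrt (?q / n) ^ 3"
    using sum_bounded_above[of "{..<n}" "\<lambda>i. sqrt (\<alpha> / (n - \<alpha> * i)) ^ 3" "sqrt (?q / n) ^ 3"] by simp
  also have "sqrt (?q / n) ^ 3 = ?q powr (3/2) / (n * sqrt n)"
  proof -
    have "sqrt (?q / n) ^ 3 = sqrt ?q ^ 3 / sqrt n ^ 3"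
      by (simp add: real_sqrt_divide real_sqrt_mult power_divide power_mult_distrib)
    also have "sqrt ?q ^ 3 = ?q powr (3/2)"
      using a by (simp add: powr_half_sqrt[symmetric] powr_power)
    also have "sqrt n ^ 3 = n * sqrt n"
      by (simp add: power3_eq_cube)
    finally show ?thesis .
  qed
  also have "n * (?q powr (3/2) / (n * sqrt n)) = (1 / sqrt n) * ?q powr (3 / 2)"
    using npos by simp
  finally show ?thesis .
qed

lemma (in prob_space) indep_vars_sum_vector:
  fixes X :: "'i \<Rightarrow> 'a \<Rightarrow> 'b :: euclidean_space"
  assumes I: "finite I" "i \<notin> I" and indep: "indep_vars (\<lambda>_. borel) X (insert i I)"
  shows "indep_var borel (X i) borel (\<lambda>\<omega>. \<Sum>i\<in>I. X i \<omega>)"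
proof -
  have "indep_var
    borel ((\<lambda>f. f i) \<circ> (\<lambda>\<omega>. restrict (\<lambda>i. X i \<omega>) {i}))
    borel ((\<lambda>f. \<Sum>i\<in>I. f i) \<circ> (\<lambda>\<omega>. restrict (\<lambda>i. X i \<omega>) I))"
    using I by (intro indep_var_compose[OF indep_var_restrict[OF indep]]) auto
  then show ?thesis by (simp add: o_def cong: rev_conj_cong)
qed

section \<open>The law of the normalized sum\<close>

text \<open>The Gaussian parts of the summands are collected into a single one, of variance \<open>n \<sigma>\<^sup>2\<close>.\<close>
lemma (in prob_space) distr_sum_smoothed:
  fixes Y :: "nat \<Rightarrow> 'a \<Rightarrow> real ^ 'd"
  assumes indep: "indep_vars (\<lambda>_. borel) Y {1..n}"
    and law: "\<And>k. 1 \<le> k \<Longrightarrow> k \<le> n \<Longrightarrow> distr M borel (Y k) = (V \<star> gauss_law \<sigma>)"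
    and V: "borel_prob V" and \<sigma>: "0 \<le> \<sigma>"
  shows "distr M borel (\<lambda>\<omega>. \<Sum>k=1..n. Y k \<omega>) = (conv_power V n \<star> gauss_law (sqrt n * \<sigma>))"
  using indep law
proof (induction n)
  case 0
  have "distr M borel (\<lambda>\<omega>. 0) = return borel (0 :: real ^ 'd)"
    by (rule distr_const) simp
  then show ?case
    by (simp add: convolution_return_0[OF prob_space_return] gauss_law_0)
next
  case (Suc n)
  have rv: "random_variable borel (Y k)" if "k \<in> {1..Suc n}" for k
    using Suc.prems(1) that unfolding indep_vars_def by auto
  let ?W = "conv_power V n" and ?G = "\<lambda>s. gauss_law s :: (real ^ 'd) measure"
  have W: "borel_prob ?W" by (rule borel_prob_conv_power[OF V])
  have ins: "{1..Suc n} = insert (Suc n) {1..n}" by auto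
  have iv: "indep_var borel (Y (Suc n)) borel (\<lambda>\<omega>. \<Sum>k\<in>{1..n}. Y k \<omega>)"
    using Suc.prems(1) unfolding ins by (intro indep_vars_sum_vector) auto
  have "distr M borel (\<lambda>\<omega>. \<Sum>k=1..Suc n. Y k \<omega>) =
      distr M borel (\<lambda>\<omega>. Y (Suc n) \<omega> + (\<Sum>k=1..n. Y k \<omega>))"
    unfolding ins by simp
  also have "\<dots> = (distr M borel (Y (Suc n)) \<star> distr M borel (\<lambda>\<omega>. \<Sum>k=1..n. Y k \<omega>))"
    by (rule sum_indep_random_variable[OF iv]) (use rv in auto)
  also have "distr M borel (Y (Suc n)) = (V \<star> ?G \<sigma>)"
    by (rule Suc.prems(2)) auto
  also have "distr M borel (\<lambda>\<omega>. \<Sum>k=1..n. Y k \<omega>) = (?W \<star> ?G (sqrt n * \<sigma>))"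
    by (rule Suc.IH) (use Suc.prems in \<open>auto intro: indep_vars_subset\<close>)
  also have "((V \<star> ?G \<sigma>) \<star> (?W \<star> ?G (sqrt n * \<sigma>))) = ((V \<star> ?W) \<star> (?G \<sigma> \<star> ?G (sqrt n * \<sigma>)))"
    by (metis V W borel_prob_gauss_law borel_prob_convolution borel_prob_convolution_assoc
        borel_prob_convolution_commute)
  also have "(?G \<sigma> \<star> ?G (sqrt n * \<sigma>)) = ?G (sqrt (Suc n) * \<sigma>)"
  proof -
    have "\<sigma>\<^sup>2 + (sqrt n * \<sigma>)\<^sup>2 = real (Suc n) * \<sigma>\<^sup>2"
      by (simp add: power_mult_distrib algebra_simps)
    then have "sqrt (\<sigma>\<^sup>2 + (sqrt n * \<sigma>)\<^sup>2) = sqrt (Suc n) * \<sigma>"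
      using \<sigma> by (simp add: real_sqrt_mult)
    then show ?thesis using \<sigma> gauss_law_convolution[of \<sigma> "sqrt n * \<sigma>", where 'd='d] by simp
  qed
  finally show ?case by simp
qed

lemma ou_inner: "ou c (\<lambda>y :: real ^ 'd. v \<bullet> y) x = c * (v \<bullet> x)"
  using L2_integrable[OF gauss.finite_measure_axioms L2_gaussian_inner[of v]] gauss.prob_space[where 'd='d]
  by (simp add: ou_def inner_add_right gaussian_first_moment del: integral_inner_right)

lemma ou_inner_square:
  assumes c: "0 < c" "c < 1"
  shows "ou c (\<lambda>y :: real ^ 'd. (v \<bullet> y)\<^sup>2) x = c\<^sup>2 * (v \<bullet> x)\<^sup>2 + (1 - c\<^sup>2) * (norm v)\<^sup>2"
proof -
  define s where "s = sqrt (1 - c\<^sup>2)"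
  have s2: "s\<^sup>2 = 1 - c\<^sup>2" using c by (simp add: s_def power_le_one)
  note i = L2_integrable[OF gauss.finite_measure_axioms L2_gaussian_inner[of v]]
    L2_integrable[OF gauss.finite_measure_axioms L2_gaussian_inner_square[of v]]
  have "ou c (\<lambda>y. (v \<bullet> y)\<^sup>2) x =
      (\<integral>y. (c\<^sup>2 * (v \<bullet> x)\<^sup>2 + (2 * c * s * (v \<bullet> x)) * (v \<bullet> y)) + s\<^sup>2 * (v \<bullet> y)\<^sup>2 \<partial>std_gaussian)"
    unfolding ou_def s_def[symmetric]
    by (intro Bochner_Integration.integral_cong) (auto simp: inner_add_right power2_eq_square algebra_simps)
  also have "\<dots> = c\<^sup>2 * (v \<bullet> x)\<^sup>2 + s\<^sup>2 * (norm v)\<^sup>2"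
    using i gauss.prob_space[where 'd='d]
    by (simp add: gaussian_first_moment gaussian_second_moment del: integral_inner_right)
  finally show ?thesis by (simp add: s2)
qed

text \<open>
  The moments of \<open>X\<close> are known and those of the unsmoothed density \<open>f\<close> are wanted. By symmetry the mean of \<open>k(X)\<close> is the
  integral of \<open>f * ou c k\<close>. Since \<open>ou c\<close> maps a linear form to \<open>c\<close> times itself and a squared linear form to
  \<open>c\<^sup>2\<close> times itself plus a constant, the moments up to order two can be solved for, one order after the other.
\<close>
lemma (in prob_space) matches_gaussian_moments_unsmooth:
  fixes X :: "'a \<Rightarrow> real ^ 'd"
  assumes dens: "distributed M std_gaussian X (\<lambda>x. ennreal (ou c f x))"
    and c: "0 < c" "c < 1" and f: "f \<in> L2_space std_gaussian" and f0: "\<And>x. 0 \<le> f x"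
    and mean: "(\<integral>\<omega>. X \<omega> \<partial>M) = 0" and cov: "covariance_matrix M X = mat 1"
  shows "matches_gaussian_moments f"
proof -
  note fin = gauss.finite_measure_axioms[where 'd='d]
  have o0: "0 \<le> ou c f x" for x unfolding ou_def using f0 by simp
  note fo = ou_L2[OF c f]
  have tr: "(\<integral>x. f x * ou c k x \<partial>std_gaussian) = (\<integral>\<omega>. k (X \<omega>) \<partial>M)"
    and ik: "integrable M (\<lambda>\<omega>. k (X \<omega>))" if k: "k \<in> L2_space std_gaussian" for k
  proof -
    have [measurable]: "k \<in> borel_measurable std_gaussian" using k by (rule L2_measurable)
    show "(\<integral>x. f x * ou c k x \<partial>std_gaussian) = (\<integral>\<omega>. k (X \<omega>) \<partial>M)"
      using distributed_integral[OF dens, of k] o0 ou_symmetric[OF c f k] by (simp add: mult.commute)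
    show "integrable M (\<lambda>\<omega>. k (X \<omega>))"
      using distributed_integrable[OF dens, of k] o0 L2_integrable_mult[OF fo k] by simp
  qed
  have one: "(\<lambda>_. 1) \<in> L2_space (std_gaussian :: (real ^ 'd) measure)"
    by (rule L2_bounded[OF fin, of _ 1]) auto
  have f1: "(\<integral>x. f x \<partial>std_gaussian) = 1"
    using tr[OF one] gauss.prob_space[where 'd='d] prob_space by (simp add: ou_def)
  have iX: "integrable M (\<lambda>\<omega>. v \<bullet> X \<omega>)" for v
    using ik[OF L2_gaussian_inner[of v]] by simp
  have iXX: "integrable M X"
  proof -
    have "integrable M (\<lambda>\<omega>. X \<omega> \<bullet> b)" for b
      using iX[of b] by (simp add: inner_commute)
    then have "integrable M (\<lambda>\<omega>. \<Sum>b\<in>Basis. (X \<omega> \<bullet> b) *\<^sub>R b)"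
      by (intro Bochner_Integration.integrable_sum integrable_scaleR_left)
    then show ?thesis
      by (simp add: euclidean_representation)
  qed
  have EX: "(\<integral>\<omega>. v \<bullet> X \<omega> \<partial>M) = 0" for v
    using iXX mean by simp
  have m1: "(\<integral>y. f y * (v \<bullet> y) \<partial>std_gaussian) = 0" for v
  proof -
    have "(\<integral>x. c * (f x * (v \<bullet> x)) \<partial>std_gaussian) = 0"
      using tr[OF L2_gaussian_inner[of v]] EX[of v] by (simp add: ou_inner mult_ac)
    then show ?thesis using c by simp
  qed
  have EXX: "(\<integral>\<omega>. (v \<bullet> X \<omega>)\<^sup>2 \<partial>M) = (norm v)\<^sup>2" for v
  proof -
    have coord: "X \<omega> $ i = axis i 1 \<bullet> X \<omega>" for i \<omega> by (simp add: inner_axis')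
    have mX: "X \<in> borel_measurable M" using iXX by simp
    have cL: "(\<lambda>\<omega>. X \<omega> $ i) \<in> L2_space M" for i
      unfolding coord using ik[OF L2_gaussian_inner_square[of "axis i 1"]] iX
      by (intro L2_spaceI) auto
    note ic = L2_integrable_mult[OF cL cL]
    have Ei: "(\<integral>\<omega>. X \<omega> $ i \<partial>M) = 0" for i
      unfolding coord by (rule EX)
    have cv: "(\<integral>\<omega>. X \<omega> $ i * X \<omega> $ j \<partial>M) = (if i = j then 1 else 0)" for i j
      using arg_cong[OF cov, of "\<lambda>A. A $ i $ j"] by (simp add: covariance_matrix_def Ei mat_def)
    have "(v \<bullet> X \<omega>)\<^sup>2 = (\<Sum>i\<in>UNIV. \<Sum>j\<in>UNIV. (v $ i * v $ j) * (X \<omega> $ i * X \<omega> $ j))" for \<omega>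
      by (simp add: inner_vec_def power2_eq_square sum_product mult_ac)
    then have "(\<integral>\<omega>. (v \<bullet> X \<omega>)\<^sup>2 \<partial>M) = (\<Sum>i\<in>UNIV. \<Sum>j\<in>UNIV. (v $ i * v $ j) * (if i = j then 1 else 0))"
      using ic by (simp add: Bochner_Integration.integral_sum cv del: mult_if_delta)
    also have "\<dots> = (\<Sum>i\<in>UNIV. v $ i * v $ i)" by (simp add: if_distrib cong: if_cong)
    also have "\<dots> = (norm v)\<^sup>2" by (simp add: power2_norm_eq_inner inner_vec_def)
    finally show ?thesis .
  qed
  have m2: "(\<integral>y. f y * (v \<bullet> y)\<^sup>2 \<partial>std_gaussian) = (norm v)\<^sup>2" for v
  proof -
    have "(norm v)\<^sup>2 = (\<integral>x. f x * (c\<^sup>2 * (v \<bullet> x)\<^sup>2 + (1 - c\<^sup>2) * (norm v)\<^sup>2) \<partial>std_gaussian)"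
      using tr[OF L2_gaussian_inner_square[of v]] EXX[of v] by (simp add: ou_inner_square[OF c])
    also have "\<dots> = (\<integral>x. c\<^sup>2 * (f x * (v \<bullet> x)\<^sup>2) + ((1 - c\<^sup>2) * (norm v)\<^sup>2) * f x \<partial>std_gaussian)"
      by (intro Bochner_Integration.integral_cong) (auto simp: algebra_simps)
    also have "\<dots> = c\<^sup>2 * (\<integral>x. f x * (v \<bullet> x)\<^sup>2 \<partial>std_gaussian) + (1 - c\<^sup>2) * (norm v)\<^sup>2"
      using L2_integrable_mult[OF f L2_gaussian_inner_square[of v]] L2_integrable[OF fin f] f1
      by simp
    finally have "c\<^sup>2 * (norm v)\<^sup>2 = c\<^sup>2 * (\<integral>x. f x * (v \<bullet> x)\<^sup>2 \<partial>std_gaussian)"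
      by (simp add: algebra_simps)
    then show ?thesis using c by simp
  qed
  show ?thesis
    unfolding matches_gaussian_moments_def using f f0 f1 m1 m2 by auto
qed

theorem corollary3p6:
  fixes M :: "'a measure"
    and X :: "nat \<Rightarrow> 'a \<Rightarrow> real ^ 'd"
    and f g :: "real ^ 'd \<Rightarrow> real"
    and \<alpha> :: real
    and n :: nat
  assumes "prob_space M"
    and indep: "prob_space.indep_vars M (\<lambda>_. borel) X {1..}"
    and ident: "\<And>k. k \<ge> 1 \<Longrightarrow> distr M borel (X k) = distr M borel (X 1)"
    and dens: "\<And>k. k \<ge> 1 \<Longrightarrow> distributed M std_gaussian (X k) (\<lambda>x. ennreal (g x))"
    and g_L2: "g \<in> L2_space std_gaussian"
    and alpha: "0 < \<alpha>" "\<alpha> < 1"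
    and f_L2: "f \<in> L2_space std_gaussian"
    and f_nonneg: "\<And>x. 0 \<le> f x"
    and g_form: "\<And>x. g x = (\<integral>y. f (sqrt \<alpha> *\<^sub>R x + sqrt (1 - \<alpha>) *\<^sub>R y) \<partial>std_gaussian)"
    and mean: "\<And>k. k \<ge> 1 \<Longrightarrow> (\<integral>\<omega>. X k \<omega> \<partial>M) = 0"
    and cov: "\<And>k. k \<ge> 1 \<Longrightarrow> covariance_matrix M (X k) = mat 1"
    and n: "real n \<ge> \<alpha> / (1 - \<alpha>)"
  shows "tv_dist (distr M borel (normalized_sum X n)) std_gaussian
         \<le> 1 / 2 * (1 / sqrt (real n)) * (\<alpha> / (1 - \<alpha>)) powr (3 / 2)
             * sqrt ((L2_norm std_gaussian f)\<^sup>2 - 1)"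
proof -
  interpret prob_space M by fact
  note fin = gauss.finite_measure_axioms[where 'd='d]
  have "0 < \<alpha> / (1 - \<alpha>)" using alpha by simp
  then have "0 < real n" using n by linarith
  then have n0: "0 < n" and npos: "0 < real n" by auto
  define c where "c = sqrt \<alpha>"
  have c: "0 < c" "c < 1" and c2: "c\<^sup>2 = \<alpha>" using alpha by (auto simp: c_def)
  have g: "g = ou c f"
    by (rule ext) (simp add: g_form ou_def c2, simp add: c_def)
  have mom: "matches_gaussian_moments f"
    using dens[of 1] mean[of 1] cov[of 1]
    by (intro matches_gaussian_moments_unsmooth[OF _ c f_L2 f_nonneg, of "X 1"]) (auto simp: g)
  then have f1: "(\<integral>x. f x \<partial>std_gaussian) = 1" by (simp add: matches_gaussian_moments_def)
  let ?\<nu> = "density std_gaussian (\<lambda>x. ennreal (f x))"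
  define V where "V = distr ?\<nu> borel (\<lambda>x. sqrt (\<alpha> / n) *\<^sub>R x)"
  define \<sigma> where "\<sigma> = sqrt ((1 - \<alpha>) / n)"
  have \<sigma>0: "0 \<le> \<sigma>" using alpha by (simp add: \<sigma>_def)
  have \<nu>: "borel_prob ?\<nu>" by (rule borel_prob_density[OF f_L2 f_nonneg f1])
  have V: "borel_prob V" unfolding V_def by (rule borel_prob_scale[OF \<nu>])
  have [measurable_cong]: "sets ?\<nu> = sets borel" using \<nu> by (rule borel_probD)
  have rv: "X k \<in> borel_measurable M" if "k \<ge> 1" for k
    using distributed_measurable[OF dens[OF that]] by (simp cong: measurable_cong_sets)
  define Y where "Y = (\<lambda>k \<omega>. (1 / sqrt n) *\<^sub>R X k \<omega>)"
  have lawY: "distr M borel (Y k) = (V \<star> gauss_law \<sigma>)" if "1 \<le> k" for k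
  proof -
    have "distr M borel (Y k) = distr (distr M borel (X k)) borel (\<lambda>x. (1 / sqrt n) *\<^sub>R x)"
      using rv[OF that] by (subst distr_distr) (auto simp: Y_def o_def)
    also have "distr M borel (X k) = distr M std_gaussian (X k)"
      by (intro distr_cong) auto
    also have "\<dots> = (distr ?\<nu> borel (\<lambda>x. c *\<^sub>R x) \<star> gauss_law (sqrt (1 - c\<^sup>2)))"
      using distributed_distr_eq_density[OF dens[OF that]] density_ou[OF c f_L2 f_nonneg] by (simp add: g)
    also have "distr \<dots> borel (\<lambda>x. (1 / sqrt n) *\<^sub>R x) = (V \<star> gauss_law \<sigma>)"
      by (simp add: convolution_scale borel_prob_scale \<nu> borel_prob_gauss_law gauss_law_scale
          distr_distr o_def V_def \<sigma>_def c2 real_sqrt_divide) (simp add: c_def)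
    finally show ?thesis .
  qed
  have indepY: "indep_vars (\<lambda>_. borel) Y {1..n}"
    unfolding Y_def
    by (rule indep_vars_compose2[OF indep_vars_subset[OF indep]]) auto
  have "distr M borel (normalized_sum X n) = distr M borel (\<lambda>\<omega>. \<Sum>k=1..n. Y k \<omega>)"
    by (simp add: normalized_sum_def[abs_def] Y_def scaleR_sum_right)
  also have "\<dots> = (conv_power V n \<star> gauss_law (sqrt n * \<sigma>))"
    by (rule distr_sum_smoothed[OF indepY lawY V \<sigma>0])
  also have "sqrt n * \<sigma> = sqrt (1 - \<alpha> * n / n)"
    using npos by (simp add: \<sigma>_def real_sqrt_divide)
  finally have law: "distr M borel (normalized_sum X n) = (conv_power V n \<star> gauss_law (sqrt (1 - \<alpha> * n / n)))" .
  let ?\<delta> = "sqrt (\<integral>x. (f x - 1)\<^sup>2 \<partial>std_gaussian)"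
  have tv: "tv_le (distr M borel (normalized_sum X n)) std_gaussian
     (\<Sum>i<n. sqrt (\<alpha> / (n - \<alpha> * i)) ^ 3 * ?\<delta> / 2)"
    unfolding law V_def by (rule lindeberg_telescope[OF mom n0 alpha order_refl])
  have \<delta>: "?\<delta> = sqrt ((L2_norm std_gaussian f)\<^sup>2 - 1)"
  proof -
    have "(\<integral>x. (f x - 1)\<^sup>2 \<partial>std_gaussian) = (\<integral>x. (f x)\<^sup>2 - 2 * f x + 1 \<partial>std_gaussian)"
      by (simp add: power2_diff algebra_simps)
    also have "\<dots> = (\<integral>x. (f x)\<^sup>2 \<partial>std_gaussian) - 1"
      using L2_integrable_square[OF f_L2] L2_integrable[OF fin f_L2] f1 gauss.prob_space[where 'd='d]
      by simp
    finally show ?thesis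
      by (simp add: L2_norm_def)
  qed
  have "(\<Sum>i<n. sqrt (\<alpha> / (n - \<alpha> * i)) ^ 3 * ?\<delta> / 2) = (\<Sum>i<n. sqrt (\<alpha> / (n - \<alpha> * i)) ^ 3) * (?\<delta> / 2)"
    by (simp add: sum_distrib_right)
  also have "\<dots> \<le> (1 / sqrt n) * (\<alpha> / (1 - \<alpha>)) powr (3 / 2) * (?\<delta> / 2)"
    by (intro mult_right_mono lindeberg_sum n0 alpha) simp
  finally have le: "(\<Sum>i<n. sqrt (\<alpha> / (n - \<alpha> * i)) ^ 3 * ?\<delta> / 2) \<le>
      1 / 2 * (1 / sqrt (real n)) * (\<alpha> / (1 - \<alpha>)) powr (3 / 2) * sqrt ((L2_norm std_gaussian f)\<^sup>2 - 1)"
    unfolding \<delta> by simp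
  show ?thesis
    unfolding tv_dist_def
  proof (rule cSUP_least)
    fix A :: "(real ^ 'd) set" assume "A \<in> sets borel"
    then show "\<bar>measure (distr M borel (normalized_sum X n)) A - measure std_gaussian A\<bar> \<le>
      1 / 2 * (1 / sqrt (real n)) * (\<alpha> / (1 - \<alpha>)) powr (3 / 2) * sqrt ((L2_norm std_gaussian f)\<^sup>2 - 1)"
      using tv le unfolding tv_le_def by (blast intro: order_trans)
  qed auto
qed

end
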